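(* Let $\Omega$ be a Hausdorff space with Borel $\sigma$-algebra $\mathcal{F}$ and let $\phi\colon B_b\to\mathbb{R}\cup\{+\infty\}$ be an increasing convex functional. If $\phi$ satisfies condition (C) or condition (D) stated in the context, then $$\phi(f)=\sup_{\mu\in ca^+_r(\mathcal{F})}\big(\langle f,\mu\rangle-\phi^*_{C_b}(\mu)\big)\quad\text{for all } f\in C_b,\tag{1}$$ $$\phi(f)\le\sup_{\mu\in ca^+_r(\mathcal{F})}\big(\langle f,\mu\rangle-\phi^*_{C_b}(\mu)\big)\quad\text{for all } f\in U_b,\tag{2}$$ $$\phi_r(f)\le\sup_{\mu\in ca^+_r(\mathcal{F})}\big(\langle f,\mu\rangle-\phi^*_{C_b}(\mu)\big)\quad\text{for all } f\in B_b,\tag{3}$$ and both inequalities (2) and (3) become equalities if $\phi^*_{C_b}(\mu)=\phi^*_{U_b}(\mu)$ for all $\mu\in ca^+_r(\mathcal{F})$. In particular, if $\phi$ is lower regular and $\phi^*_{C_b}(\mu)=\phi^*_{U_b}(\mu)$ for all $\mu\in ca^+_r(\mathcal{F})$, then $$\phi(f)=\sup_{\mu\in ca^+_r(\mathcal{F})}\big(\langle f,\mu\rangle-\phi^*_{C_b}(\mu)\big)\quad\text{for all } f\in B_b.$$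
   Context: $B_b$, $C_b$ and $U_b$ denote the sets of all bounded Borel measurable, bounded continuous, and bounded upper semicontinuous functions $f\colon\Omega\to\mathbb{R}$, respectively. Inequalities between functions are pointwise. $\phi$ is *increasing convex* if it is convex and $\phi(f)\ge\phi(g)$ whenever $f\ge g$. $\langle f,\mu\rangle:=\int_\Omega f\,d\mu$. A finite (countably additive, nonnegative) measure $\mu$ on $\mathcal{F}$ is *regular* if $\mu(A)=\sup\{\mu(B): B\in\mathcal{F},\ B\text{ closed and compact},\ B\subseteq A\}$ for all $A\in\mathcal{F}$; $ca^+_r(\mathcal{F})$ is the collection of all regular finite measures on $\mathcal{F}$. For $\mu\in ca_r^+(\mathcal{F})$, $$\phi^*_{C_b}(\mu):=\sup_{f\in C_b}(\langle f,\mu\rangle-\phi(f)),\qquad \phi^*_{U_b}(\mu):=\sup_{f\in U_b}(\langle f,\mu\rangle-\phi(f)).$$ Suprema are taken in $[-\infty,+\infty]$; if $\phi\equiv+\infty$ the conjugates equal $-\infty$ and $\langle f,\mu\rangle-(-\infty)=+\infty$. The lower regularization of $\phi$ is $\phi_r(f):=\sup\{\phi(g): g\in U_b,\ g\le f\}$, $f\in B_b$; $\phi$ is *lower regular* if $\phi=\phi_r$. A sequence $(K_n)$ of subsets of $\Omega$ is increasing if $K_n\subseteq K_{n+1}$ for all $n$, and a sequence $(f_n)$ of functions is increasing if $f_n\le f_{n+1}$ for all $n$. $\phi(f_n)\uparrow\phi(f)$ means convergence from below. **Condition (C).** $\phi$ is real-valued and there exists an increasing sequence $(K_n)$ of compact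 subsets of $\Omega$ such that $\phi(f_n)\uparrow\phi(f)$ for every increasing sequence $(f_n)$ in $B_b$ and $f\in B_b$ such that $|f-f_n|1_{K_m}=0$ for all $n\ge m$ (and all $m$). **Condition (D).** There exists an increasing sequence $(K_n)$ of compact subsets of $\Omega$ such that $\phi(f_n)\uparrow\phi(f)$ for every increasing sequence $(f_n)$ in $B_b$ and $f\in B_b$ such that $|f-f_n|1_{K_m}\le 1/m$ for all $n\ge m$ (and all $m$). *)

theory Defs
  imports "HOL-Analysis.Analysis"
begin

definition upper_semicontinuous :: "('a::topological_space \<Rightarrow> real) \<Rightarrow> bool" where
  "upper_semicontinuous f \<longleftrightarrow> (\<forall>c. open {x. f x < c})"

definition B_b :: "('a::topological_space \<Rightarrow> real) set" where
  "B_b = {f. f \<in> borel_measurable borel \<and> bounded (range f)}"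

definition C_b :: "('a::topological_space \<Rightarrow> real) set" where
  "C_b = {f. continuous_on UNIV f \<and> bounded (range f)}"

definition U_b :: "('a::topological_space \<Rightarrow> real) set" where
  "U_b = {f. upper_semicontinuous f \<and> bounded (range f)}"

text \<open>
  A functional from \<open>B_b\<close> to the reals extended by plus infinity is a function into \<open>ereal\<close>
  of which only the values on \<open>B_b\<close> matter; those must not be minus infinity.  Inequalities between
  functions are the pointwise order of the function type, and \<open>incseq\<close> below refers to that order
  (for functions) or to inclusion (for sets).
\<close>

definition increasing_convex :: "(('a::topological_space \<Rightarrow> real) \<Rightarrow> ereal) \<Rightarrow> bool" where
  "increasing_convex \<phi> \<longleftrightarrow>
     (\<forall>f\<in>B_b. \<forall>g\<in>B_b. \<forall>t::real. 0 < t \<and> t < 1 \<longrightarrow>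
        \<phi> (\<lambda>x. t * f x + (1 - t) * g x) \<le> ereal t * \<phi> f + ereal (1 - t) * \<phi> g) \<and>
     (\<forall>f\<in>B_b. \<forall>g\<in>B_b. g \<le> f \<longrightarrow> \<phi> g \<le> \<phi> f)"

definition regular_measure :: "'a::topological_space measure \<Rightarrow> bool" where
  "regular_measure \<mu> \<longleftrightarrow>
     (\<forall>A\<in>sets borel. emeasure \<mu> A =
        (SUP B\<in>{B \<in> sets borel. closed B \<and> compact B \<and> B \<subseteq> A}. emeasure \<mu> B))"

definition ca_r_plus :: "'a::topological_space measure set" where
  "ca_r_plus = {\<mu>. sets \<mu> = sets borel \<and> finite_measure \<mu> \<and> regular_measure \<mu>}"

text \<open>
  The difference is taken in \<open>ereal\<close>, where subtracting minus infinity from a real number gives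
  plus infinity.  The first argument is \<open>C_b\<close> or \<open>U_b\<close>.
\<close>

definition conjugate ::
    "('a::topological_space \<Rightarrow> real) set \<Rightarrow> (('a \<Rightarrow> real) \<Rightarrow> ereal) \<Rightarrow> 'a measure \<Rightarrow> ereal" where
  "conjugate X \<phi> \<mu> = (SUP f\<in>X. ereal (integral\<^sup>L \<mu> f) - \<phi> f)"

definition lower_regularization ::
    "(('a::topological_space \<Rightarrow> real) \<Rightarrow> ereal) \<Rightarrow> ('a \<Rightarrow> real) \<Rightarrow> ereal" where
  "lower_regularization \<phi> f = (SUP g\<in>{g \<in> U_b. g \<le> f}. \<phi> g)"

definition lower_regular :: "(('a::topological_space \<Rightarrow> real) \<Rightarrow> ereal) \<Rightarrow> bool" where
  "lower_regular \<phi> \<longleftrightarrow> (\<forall>f\<in>B_b. \<phi> f = lower_regularization \<phi> f)"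

definition converges_from_below :: "(nat \<Rightarrow> ereal) \<Rightarrow> ereal \<Rightarrow> bool" where
  "converges_from_below a l \<longleftrightarrow> (\<forall>n. a n \<le> l) \<and> a \<longlonglongrightarrow> l"

text \<open>
  In both conditions the sequences are indexed from 0 instead of 1, so that \<open>K m\<close> and \<open>f_seq n\<close> stand
  for the usual \<open>(m+1)\<close>-st and \<open>(n+1)\<close>-st terms.  This is why the bound in condition (D) is the
  reciprocal of \<open>Suc m\<close>.
\<close>

definition condition_C :: "(('a::topological_space \<Rightarrow> real) \<Rightarrow> ereal) \<Rightarrow> bool" where
  "condition_C \<phi> \<longleftrightarrow>
     (\<forall>f\<in>B_b. \<bar>\<phi> f\<bar> \<noteq> \<infinity>) \<and>
     (\<exists>K :: nat \<Rightarrow> 'a set. incseq K \<and> (\<forall>m. compact (K m)) \<and>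
        (\<forall>f_seq f. incseq f_seq \<and> (\<forall>n. f_seq n \<in> B_b) \<and> f \<in> B_b \<and>
           (\<forall>m n. m \<le> n \<longrightarrow> (\<forall>x. \<bar>f x - f_seq n x\<bar> * indicator (K m) x = 0))
           \<longrightarrow> converges_from_below (\<lambda>n. \<phi> (f_seq n)) (\<phi> f)))"

definition condition_D :: "(('a::topological_space \<Rightarrow> real) \<Rightarrow> ereal) \<Rightarrow> bool" where
  "condition_D \<phi> \<longleftrightarrow>
     (\<exists>K :: nat \<Rightarrow> 'a set. incseq K \<and> (\<forall>m. compact (K m)) \<and>
        (\<forall>f_seq f. incseq f_seq \<and> (\<forall>n. f_seq n \<in> B_b) \<and> f \<in> B_b \<and>
           (\<forall>m n. m \<le> n \<longrightarrow>
              (\<forall>x. \<bar>f x - f_seq n x\<bar> * indicator (K m) x \<le> 1 / real (Suc m)))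
           \<longrightarrow> converges_from_below (\<lambda>n. \<phi> (f_seq n)) (\<phi> f)))"

end

theory Submission
  imports Defs
begin

text \<open>
  The easy halves are Fenchel's inequality: \<open>\<langle>f, \<mu>\<rangle> - \<phi>\<^sup>*(\<mu>) \<le> \<phi> f\<close> holds for every \<open>f\<close> in the class over
  which the conjugate is taken, and it passes from \<open>U_b\<close> to the lower regularization on \<open>B_b\<close> because
  the integral of a bounded Borel function against a regular measure is the supremum of the integrals
  of the bounded upper semicontinuous functions below it (\<open>integral_inner_approx\<close>).

  For the hard half, let \<open>f \<in> U_b\<close> and \<open>c < \<phi> f\<close>.  It suffices to find a regular measure \<open>\<mu>\<close> with
  \<open>c + \<langle>g, \<mu>\<rangle> - \<langle>f, \<mu>\<rangle> \<le> \<phi> g\<close> for all \<open>g \<in> C_b\<close> (\<open>supporting_measure\<close>).  Both conditions allow \<open>f\<close>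
  to be lowered by a small constant \<open>\<epsilon>\<close> and then, one unit at a time, outside sets \<open>K\<^bsub>N 0\<^esub> \<subseteq> K\<^bsub>N 1\<^esub> \<subseteq> \<dots>\<close> chosen
  so sparsely that \<open>\<phi>\<close> stays above \<open>c\<close>.  Every bounded \<open>g\<close> above \<open>f - \<epsilon> - \<Sum>j. 1\<^bsub>- K (N j)\<^esub>\<close> lies above one
  of these functions, so that \<open>c < \<phi> g\<close> on a neighbourhood of \<open>f\<close> of the form \<open>w * (f - g) \<le> 1\<close>, where
  the weight \<open>w\<close> tends to \<open>0\<close> along the complements of the \<open>K n\<close> (\<open>weighted_neighbourhood\<close>).  By
  convexity \<open>\<phi> g\<close> is at least \<open>c\<close> minus the gauge \<open>sup (w * (f - g))\<^sup>+\<close> of such a neighbourhood, for all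
  \<open>g\<close> (\<open>gauge_minorant\<close>), and the Hahn-Banach theorem gives a linear functional \<open>L\<close> on \<open>B_b\<close> below the
  gauge with \<open>c + L g - L f \<le> \<phi> g\<close> (\<open>tight_supporting_functional\<close>).  The bound by the gauge makes \<open>L\<close>
  positive and makes \<open>L 1\<^bsub>- K n\<^esub>\<close> tend to \<open>0\<close>.

  Thus \<open>A \<mapsto> L 1\<^bsub>A\<^esub>\<close> is a finitely additive, tight set function.  Regularising it from outside by open sets
  on the compact sets, then from inside on the open sets, and then from outside again yields an outer
  measure for which all Borel sets are measurable.  This needs no more than the separation of disjoint
  compact sets, so that neither local compactness nor many continuous functions are required.  The
  resulting regular measure has the same total mass and is at least as large on closed sets, whence
  \<open>L f \<le> \<langle>f, \<mu>\<rangle>\<close> for all \<open>f \<in> U_b\<close>, with equality on \<open>C_b = U_b \<inter> - U_b\<close>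
  (\<open>measure_dominating_functional\<close>).
\<close>

section \<open>A Hahn-Banach theorem with linear constraints\<close>

text \<open>A linear space of real functions, with pointwise operations written out as abstractions.\<close>

definition function_space :: "('a \<Rightarrow> real) set \<Rightarrow> bool" where
  "function_space V \<longleftrightarrow> (\<lambda>x. 0) \<in> V \<and> (\<forall>f\<in>V. \<forall>g\<in>V. (\<lambda>x. f x + g x) \<in> V) \<and>
     (\<forall>a. \<forall>f\<in>V. (\<lambda>x. a * f x) \<in> V)"

text \<open>Only values on \<open>V\<close> matter here and in the next definition.\<close>

definition sublinear_on :: "('a \<Rightarrow> real) set \<Rightarrow> (('a \<Rightarrow> real) \<Rightarrow> real) \<Rightarrow> bool" where
  "sublinear_on V q \<longleftrightarrow> (\<forall>f\<in>V. \<forall>g\<in>V. q (\<lambda>x. f x + g x) \<le> q f + q g) \<and>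
     (\<forall>a\<ge>0. \<forall>f\<in>V. q (\<lambda>x. a * f x) = a * q f)"

definition linear_on :: "('a \<Rightarrow> real) set \<Rightarrow> (('a \<Rightarrow> real) \<Rightarrow> real) \<Rightarrow> bool" where
  "linear_on V L \<longleftrightarrow> (\<forall>f\<in>V. \<forall>g\<in>V. L (\<lambda>x. f x + g x) = L f + L g) \<and>
     (\<forall>a. \<forall>f\<in>V. L (\<lambda>x. a * f x) = a * L f)"

text \<open>A convex cone in the product of the function space with the real line; a pair \<open>(h, s)\<close> stands
  for the constraint that a functional be at most \<open>s\<close> at \<open>h\<close>.\<close>

definition constraint_cone :: "('a \<Rightarrow> real) set \<Rightarrow> (('a \<Rightarrow> real) \<times> real) set \<Rightarrow> bool" where
  "constraint_cone V G \<longleftrightarrow> fst ` G \<subseteq> V \<and> ((\<lambda>x. 0), 0) \<in> G \<and>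
     (\<forall>h s k t. (h, s) \<in> G \<and> (k, t) \<in> G \<longrightarrow> ((\<lambda>x. h x + k x), s + t) \<in> G) \<and>
     (\<forall>a\<ge>0. \<forall>h s. (h, s) \<in> G \<longrightarrow> ((\<lambda>x. a * h x), a * s) \<in> G)"

lemma function_space_add: "function_space V \<Longrightarrow> f \<in> V \<Longrightarrow> g \<in> V \<Longrightarrow> (\<lambda>x. f x + g x) \<in> V"
  and function_space_scale: "function_space V \<Longrightarrow> f \<in> V \<Longrightarrow> (\<lambda>x. a * f x) \<in> V"
  and function_space_zero: "function_space V \<Longrightarrow> (\<lambda>x. 0) \<in> V"
  by (auto simp: function_space_def)

lemma function_space_minus: "function_space V \<Longrightarrow> f \<in> V \<Longrightarrow> (\<lambda>x. - f x) \<in> V"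
  using function_space_scale[of V f "-1"] by simp

lemma function_space_diff:
  "function_space V \<Longrightarrow> f \<in> V \<Longrightarrow> g \<in> V \<Longrightarrow> (\<lambda>x. f x - g x) \<in> V"
  using function_space_add[OF _ _ function_space_minus, of V f g] by simp

lemma sublinear_on_add:
  "sublinear_on V q \<Longrightarrow> f \<in> V \<Longrightarrow> g \<in> V \<Longrightarrow> q (\<lambda>x. f x + g x) \<le> q f + q g"
  and sublinear_on_scale: "sublinear_on V q \<Longrightarrow> 0 \<le> a \<Longrightarrow> f \<in> V \<Longrightarrow> q (\<lambda>x. a * f x) = a * q f"
  by (auto simp: sublinear_on_def)

lemma sublinear_on_zero: "sublinear_on V q \<Longrightarrow> function_space V \<Longrightarrow> q (\<lambda>x. 0) = 0"
  using sublinear_on_scale[of V q 0 "\<lambda>x. 0"] function_space_zero[of V] by simp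

lemma sublinear_on_minus:
  assumes "sublinear_on V q" "function_space V" "f \<in> V"
  shows "- q (\<lambda>x. - f x) \<le> q f"
  using sublinear_on_add[OF assms(1,3) function_space_minus[OF assms(2,3)]]
    sublinear_on_zero[OF assms(1,2)] by simp

lemma linear_on_add:
  "linear_on V L \<Longrightarrow> f \<in> V \<Longrightarrow> g \<in> V \<Longrightarrow> L (\<lambda>x. f x + g x) = L f + L g"
  and linear_on_scale: "linear_on V L \<Longrightarrow> f \<in> V \<Longrightarrow> L (\<lambda>x. a * f x) = a * L f"
  by (auto simp: linear_on_def)

lemma linear_on_diff:
  assumes "linear_on V L" "function_space V" "f \<in> V" "g \<in> V"
  shows "L (\<lambda>x. f x - g x) = L f - L g"
  using linear_on_add[OF assms(1,3) function_space_minus[OF assms(2,4)]]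
    linear_on_scale[OF assms(1,4), of "-1"] by simp

lemma sublinear_onI:
  assumes V: "function_space V"
    and add: "\<And>f g. f \<in> V \<Longrightarrow> g \<in> V \<Longrightarrow> q (\<lambda>x. f x + g x) \<le> q f + q g"
    and scale_le: "\<And>a f. 0 < a \<Longrightarrow> f \<in> V \<Longrightarrow> q (\<lambda>x. a * f x) \<le> a * q f"
    and zero: "q (\<lambda>x. 0) \<le> 0"
  shows "sublinear_on V q"
proof -
  have q0: "q (\<lambda>x. 0) = 0"
    using zero add[OF function_space_zero[OF V] function_space_zero[OF V]] by simp
  have "q (\<lambda>x. a * f x) = a * q f" if a: "0 \<le> a" and f: "f \<in> V" for a f
  proof (cases "a = 0")
    case True then show ?thesis by (simp add: q0)
  next
    case False
    then have a: "0 < a" using a by simp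
    have "q (\<lambda>x. inverse a * (a * f x)) \<le> inverse a * q (\<lambda>x. a * f x)"
      using a by (intro scale_le function_space_scale V f) simp_all
    moreover have "(\<lambda>x. inverse a * (a * f x)) = f" using a by (auto simp: field_simps)
    ultimately have "q f \<le> inverse a * q (\<lambda>x. a * f x)" by simp
    then have "a * q f \<le> q (\<lambda>x. a * f x)" using a by (simp add: field_simps)
    with scale_le[OF a f] show ?thesis by (rule antisym)
  qed
  with add show ?thesis by (simp add: sublinear_on_def)
qed

text \<open>The constraints are imposed by passing to \<open>Q f = inf (q (f - h) + s)\<close> over all \<open>(h, s)\<close> in the
  cone.  The compatibility assumption, constraint by constraint, is what keeps \<open>Q\<close> finite.\<close>

lemma cone_infimum_sublinear:
  assumes V: "function_space V" and q: "sublinear_on V q" and G: "constraint_cone V G"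
    and compat: "\<And>h s. (h, s) \<in> G \<Longrightarrow> 0 \<le> q (\<lambda>x. - h x) + s"
  shows "\<exists>Q. sublinear_on V Q \<and> (\<forall>f\<in>V. Q f \<le> q f) \<and> (\<forall>h s. (h, s) \<in> G \<longrightarrow> Q h \<le> s) \<and>
    (\<forall>f. f \<notin> V \<longrightarrow> Q f = 0)"
proof -
  define S where "S f = (\<lambda>(h, s). q (\<lambda>x. f x - h x) + s) ` G" for f
  define Q where "Q f = (if f \<in> V then Inf (S f) else 0)" for f
  have GV: "h \<in> V" if "(h, s) \<in> G" for h s
    using G that by (force simp: constraint_cone_def)
  have G0: "((\<lambda>x. 0), 0) \<in> G" using G by (simp add: constraint_cone_def)
  have lower: "- q (\<lambda>x. - f x) \<le> y" if f: "f \<in> V" and y: "y \<in> S f" for f y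
  proof -
    obtain h s where hs: "(h, s) \<in> G" and y: "y = q (\<lambda>x. f x - h x) + s"
      using y by (auto simp: S_def)
    have "q (\<lambda>x. (f x - h x) + - f x) \<le> q (\<lambda>x. f x - h x) + q (\<lambda>x. - f x)"
      by (intro sublinear_on_add[OF q] function_space_diff function_space_minus V f GV[OF hs])
    with compat[OF hs] show ?thesis by (simp add: y)
  qed
  have bdd: "bdd_below (S f)" if "f \<in> V" for f
    using lower[OF that] by (auto simp: bdd_below_def)
  have ne: "S f \<noteq> {}" for f using G0 by (auto simp: S_def)
  have Q_le: "Q f \<le> q (\<lambda>x. f x - h x) + s" if "f \<in> V" "(h, s) \<in> G" for f h s
  proof -
    have "q (\<lambda>x. f x - h x) + s \<in> S f" using that(2) by (force simp: S_def)
    then show ?thesis using cInf_lower bdd[OF that(1)] that(1) by (simp add: Q_def)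
  qed
  have near: "\<exists>h s. (h, s) \<in> G \<and> q (\<lambda>x. f x - h x) + s < Q f + e" if "f \<in> V" "0 < e" for f e
  proof -
    have "Inf (S f) < Q f + e" using that by (simp add: Q_def)
    then show ?thesis using cInf_lessD[OF ne] by (fastforce simp: S_def)
  qed
  have add: "Q (\<lambda>x. f x + g x) \<le> Q f + Q g" if f: "f \<in> V" and g: "g \<in> V" for f g
  proof (rule field_le_epsilon)
    fix e :: real assume "0 < e"
    then have e: "0 < e / 2" by simp
    obtain h s where hs: "(h, s) \<in> G" "q (\<lambda>x. f x - h x) + s < Q f + e / 2"
      using near[OF f e] by blast
    obtain k t where kt: "(k, t) \<in> G" "q (\<lambda>x. g x - k x) + t < Q g + e / 2"
      using near[OF g e] by blast
    have "((\<lambda>x. h x + k x), s + t) \<in> G" using G hs kt by (simp add: constraint_cone_def)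
    then have "Q (\<lambda>x. f x + g x) \<le> q (\<lambda>x. f x + g x - (h x + k x)) + (s + t)"
      by (rule Q_le[OF function_space_add[OF V f g]])
    also have "(\<lambda>x. f x + g x - (h x + k x)) = (\<lambda>x. (f x - h x) + (g x - k x))" by auto
    also have "q \<dots> \<le> q (\<lambda>x. f x - h x) + q (\<lambda>x. g x - k x)"
      by (intro sublinear_on_add[OF q] function_space_diff V f g GV[OF hs(1)] GV[OF kt(1)])
    finally show "Q (\<lambda>x. f x + g x) \<le> Q f + Q g + e" using hs kt by simp
  qed
  have below: "Q f \<le> q f" if "f \<in> V" for f using Q_le[OF that G0] by simp
  have scale_le: "Q (\<lambda>x. a * f x) \<le> a * Q f" if a: "0 < a" and f: "f \<in> V" for a f
  proof (rule field_le_epsilon)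
    fix e :: real assume "0 < e"
    then have e: "0 < e / a" using a by simp
    obtain h s where hs: "(h, s) \<in> G" "q (\<lambda>x. f x - h x) + s < Q f + e / a"
      using near[OF f e] by blast
    have "((\<lambda>x. a * h x), a * s) \<in> G" using G hs a by (simp add: constraint_cone_def)
    then have "Q (\<lambda>x. a * f x) \<le> q (\<lambda>x. a * f x - a * h x) + a * s"
      by (rule Q_le[OF function_space_scale[OF V f]])
    also have "(\<lambda>x. a * f x - a * h x) = (\<lambda>x. a * (f x - h x))" by (auto simp: algebra_simps)
    also have "q \<dots> = a * q (\<lambda>x. f x - h x)"
      using a by (intro sublinear_on_scale[OF q] function_space_diff V f GV[OF hs(1)]) simp
    also have "\<dots> + a * s = a * (q (\<lambda>x. f x - h x) + s)" by (simp add: algebra_simps)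
    also have "\<dots> \<le> a * (Q f + e / a)" using a hs by (intro mult_left_mono) simp_all
    also have "\<dots> = a * Q f + e" using a by (simp add: field_simps)
    finally show "Q (\<lambda>x. a * f x) \<le> a * Q f + e" .
  qed
  have cone: "Q h \<le> s" if "(h, s) \<in> G" for h s
    using Q_le[OF GV[OF that] that] sublinear_on_zero[OF q V] by simp
  have "sublinear_on V Q"
    using below[OF function_space_zero[OF V]] sublinear_on_zero[OF q V]
    by (intro sublinear_onI V add scale_le) simp_all
  moreover have "\<forall>f. f \<notin> V \<longrightarrow> Q f = 0" by (simp add: Q_def)
  ultimately show ?thesis using below cone by blast
qed

text \<open>Zorn's lemma: the infimum of a chain of sublinear functionals is sublinear.
  Functionals are normalised to vanish off the space, so that the pointwise order on them is
  antisymmetric.\<close>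

lemma minimal_sublinear_exists:
  assumes V: "function_space V" and q: "sublinear_on V q" and q0: "\<forall>f. f \<notin> V \<longrightarrow> q f = 0"
  shows "\<exists>m. sublinear_on V m \<and> (\<forall>f. f \<notin> V \<longrightarrow> m f = 0) \<and> m \<le> q \<and>
    (\<forall>r. sublinear_on V r \<and> (\<forall>f. f \<notin> V \<longrightarrow> r f = 0) \<and> r \<le> m \<longrightarrow> r = m)"
proof -
  define A where "A = {r. sublinear_on V r \<and> (\<forall>f. f \<notin> V \<longrightarrow> r f = 0) \<and> r \<le> q}"
  have qA: "q \<in> A" using q q0 by (simp add: A_def)
  have "\<exists>m\<in>A. \<forall>a\<in>A. a \<le> m \<longrightarrow> a = m"
  proof (rule predicate_Zorn)
    show "partial_order_on A (relation_of (\<lambda>x y. y \<le> x) A)"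
      by (auto simp: partial_order_on_def preorder_on_def refl_on_def trans_def antisym_def
          relation_of_def)
  next
    fix C assume "C \<in> Chains (relation_of (\<lambda>x y. y \<le> x) A)"
    then have CA: "C \<subseteq> A" and tot: "\<And>r s. r \<in> C \<Longrightarrow> s \<in> C \<Longrightarrow> r \<le> s \<or> s \<le> r"
      by (auto simp: Chains_def relation_of_def)
    show "\<exists>u\<in>A. \<forall>a\<in>C. u \<le> a"
    proof (cases "C = {}")
      case True then show ?thesis using qA by auto
    next
      case ne: False
      define u where "u f = (if f \<in> V then INF r\<in>C. r f else 0)" for f
      have sub: "sublinear_on V r" and off: "f \<notin> V \<Longrightarrow> r f = 0" and rq: "r \<le> q"
        if "r \<in> C" for r f using CA that by (auto simp: A_def)
      have bdd: "bdd_below ((\<lambda>r. r f) ` C)" if f: "f \<in> V" for f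
      proof (rule bdd_belowI2)
        fix r assume r: "r \<in> C"
        have "- q (\<lambda>x. - f x) \<le> - r (\<lambda>x. - f x)" using rq[OF r] by (simp add: le_fun_def)
        also have "\<dots> \<le> r f" by (rule sublinear_on_minus[OF sub[OF r] V f])
        finally show "- q (\<lambda>x. - f x) \<le> r f" .
      qed
      have u_le: "u f \<le> r f" if "r \<in> C" for r f
        using that bdd by (auto simp: u_def off intro: cINF_lower)
      have near: "\<exists>r\<in>C. r f < u f + e" if "f \<in> V" "0 < e" for f e
      proof -
        have "(INF r\<in>C. r f) < u f + e" using that by (simp add: u_def)
        then show ?thesis using cINF_less_iff[OF ne bdd[OF that(1)]] by blast
      qed
      have add: "u (\<lambda>x. f x + g x) \<le> u f + u g" if f: "f \<in> V" and g: "g \<in> V" for f g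
      proof (rule field_le_epsilon)
        fix e :: real assume "0 < e"
        then have e: "0 < e / 2" by simp
        obtain r where r: "r \<in> C" "r f < u f + e / 2" using near[OF f e] by blast
        obtain s where s: "s \<in> C" "s g < u g + e / 2" using near[OF g e] by blast
        \<comment> \<open>The smaller of the two members of the chain serves both functions.\<close>
        obtain t where t: "t \<in> C" "t f \<le> r f" "t g \<le> s g"
          using tot[OF r(1) s(1)] r s by (auto simp: le_fun_def)
        have "u (\<lambda>x. f x + g x) \<le> t (\<lambda>x. f x + g x)" by (rule u_le[OF t(1)])
        also have "\<dots> \<le> t f + t g" by (rule sublinear_on_add[OF sub[OF t(1)] f g])
        finally show "u (\<lambda>x. f x + g x) \<le> u f + u g + e" using t r s by simp
      qed
      have scale: "u (\<lambda>x. a * f x) \<le> a * u f" if a: "0 < a" and f: "f \<in> V" for a f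
      proof (rule field_le_epsilon)
        fix e :: real assume "0 < e"
        then have e: "0 < e / a" using a by simp
        obtain r where r: "r \<in> C" "r f < u f + e / a" using near[OF f e] by blast
        have "u (\<lambda>x. a * f x) \<le> r (\<lambda>x. a * f x)" by (rule u_le[OF r(1)])
        also have "\<dots> = a * r f" using a by (intro sublinear_on_scale[OF sub[OF r(1)] _ f]) simp
        also have "\<dots> \<le> a * (u f + e / a)" using a r by (intro mult_left_mono) simp_all
        also have "\<dots> = a * u f + e" using a by (simp add: field_simps)
        finally show "u (\<lambda>x. a * f x) \<le> a * u f + e" .
      qed
      obtain r where r: "r \<in> C" using ne by blast
      have "u (\<lambda>x. 0) \<le> 0" using u_le[OF r, of "\<lambda>x. 0"] sublinear_on_zero[OF sub[OF r] V] by simp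
      then have "sublinear_on V u" by (intro sublinear_onI V add scale)
      moreover have "u \<le> q"
        by (rule order_trans[OF le_funI rq[OF r]]) (rule u_le[OF r])
      ultimately have "u \<in> A" by (simp add: A_def u_def)
      then show ?thesis using u_le by (auto simp: le_fun_def)
    qed
  qed
  then obtain m where m: "m \<in> A" and min: "\<And>a. a \<in> A \<Longrightarrow> a \<le> m \<Longrightarrow> a = m" by blast
  have "r = m" if "sublinear_on V r" "\<forall>f. f \<notin> V \<longrightarrow> r f = 0" "r \<le> m" for r
  proof (rule min)
    have "m \<le> q" using m by (simp add: A_def)
    then have "r \<le> q" by (rule order_trans[OF that(3)])
    then show "r \<in> A" using that by (simp add: A_def)
  qed fact
  with m show ?thesis unfolding A_def by (intro exI[of _ m]) auto
qed

text \<open>By minimality \<open>m\<close> already satisfies every compatible constraint.  The constraint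
  \<open>m (- y) \<le> - m y\<close> is compatible, so \<open>m\<close> is odd, and an odd sublinear functional is linear.\<close>

lemma minimal_sublinear_linear:
  assumes V: "function_space V" and m: "sublinear_on V m" and off: "\<forall>f. f \<notin> V \<longrightarrow> m f = 0"
    and min: "\<And>r. sublinear_on V r \<Longrightarrow> \<forall>f. f \<notin> V \<longrightarrow> r f = 0 \<Longrightarrow> r \<le> m \<Longrightarrow> r = m"
  shows "linear_on V m"
proof -
  have odd: "m (\<lambda>x. - y x) = - m y" if y: "y \<in> V" for y
  proof (rule antisym)
    define G where "G = (\<lambda>t. ((\<lambda>x. t * - y x), t * - m y)) ` {0..}"
    have "constraint_cone V G"
      unfolding constraint_cone_def
    proof (intro conjI allI impI)
      show "fst ` G \<subseteq> V"
        using function_space_scale[OF V function_space_minus[OF V y]] by (auto simp: G_def)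
      show "((\<lambda>x. 0), 0) \<in> G" by (auto simp: G_def image_iff intro!: bexI[of _ 0])
      fix h s k t assume "(h, s) \<in> G \<and> (k, t) \<in> G"
      then obtain a b where "0 \<le> a" "0 \<le> b" "h = (\<lambda>x. a * - y x)" "k = (\<lambda>x. b * - y x)"
        "s = a * - m y" "t = b * - m y" by (auto simp: G_def)
      then show "((\<lambda>x. h x + k x), s + t) \<in> G"
        by (auto simp: G_def image_iff algebra_simps intro!: bexI[of _ "a + b"])
    next
      fix a :: real and h s assume "0 \<le> a" "(h, s) \<in> G"
      moreover from this obtain b where "0 \<le> b" "h = (\<lambda>x. b * - y x)" "s = b * - m y"
        by (auto simp: G_def)
      ultimately show "((\<lambda>x. a * h x), a * s) \<in> G"
        by (auto simp: G_def image_iff algebra_simps intro!: bexI[of _ "a * b"])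
    qed
    moreover have "0 \<le> m (\<lambda>x. - h x) + s" if "(h, s) \<in> G" for h s
      using that sublinear_on_scale[OF m _ y] by (auto simp: G_def)
    ultimately obtain Q where Q: "sublinear_on V Q" "\<forall>f\<in>V. Q f \<le> m f"
      "\<And>h s. (h, s) \<in> G \<Longrightarrow> Q h \<le> s" "\<forall>f. f \<notin> V \<longrightarrow> Q f = 0"
      using cone_infimum_sublinear[OF V m] by blast
    have "Q f \<le> m f" for f using Q(2,4) off by (cases "f \<in> V") simp_all
    then have "Q = m" using Q(1,4) by (intro min le_funI)
    moreover have "((\<lambda>x. - y x), - m y) \<in> G" by (auto simp: G_def image_iff intro!: bexI[of _ 1])
    ultimately show "m (\<lambda>x. - y x) \<le> - m y" using Q(3) by blast
    show "- m y \<le> m (\<lambda>x. - y x)"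
      using sublinear_on_minus[OF m V function_space_minus[OF V y]] by simp
  qed
  have "m (\<lambda>x. f x + g x) = m f + m g" if f: "f \<in> V" and g: "g \<in> V" for f g
  proof (rule antisym)
    show "m (\<lambda>x. f x + g x) \<le> m f + m g" by (rule sublinear_on_add[OF m f g])
    have "m (\<lambda>x. (f x + g x) + - g x) \<le> m (\<lambda>x. f x + g x) + m (\<lambda>x. - g x)"
      by (intro sublinear_on_add[OF m] function_space_add function_space_minus V f g)
    then show "m f + m g \<le> m (\<lambda>x. f x + g x)" using odd[OF g] by simp
  qed
  moreover have "m (\<lambda>x. a * f x) = a * m f" if f: "f \<in> V" for a f
  proof (cases "0 \<le> a")
    case True then show ?thesis by (rule sublinear_on_scale[OF m _ f])
  next
    case False
    then have "m (\<lambda>x. (- a) * f x) = - a * m f" by (intro sublinear_on_scale[OF m _ f]) simp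
    then show ?thesis using odd[OF function_space_scale[OF V f, of a]] by simp
  qed
  ultimately show ?thesis by (simp add: linear_on_def)
qed

theorem linear_below_sublinear_with_constraints:
  assumes V: "function_space V" and q: "sublinear_on V q" and G: "constraint_cone V G"
    and compat: "\<And>h s. (h, s) \<in> G \<Longrightarrow> 0 \<le> q (\<lambda>x. - h x) + s"
  shows "\<exists>L. linear_on V L \<and> (\<forall>f\<in>V. L f \<le> q f) \<and> (\<forall>h s. (h, s) \<in> G \<longrightarrow> L h \<le> s)"
proof -
  obtain Q where Q: "sublinear_on V Q" "\<forall>f\<in>V. Q f \<le> q f" "\<forall>h s. (h, s) \<in> G \<longrightarrow> Q h \<le> s"
    "\<forall>f. f \<notin> V \<longrightarrow> Q f = 0"
    using cone_infimum_sublinear[OF assms] by blast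
  obtain m where m: "sublinear_on V m" "\<forall>f. f \<notin> V \<longrightarrow> m f = 0" "m \<le> Q"
    "\<And>r. sublinear_on V r \<Longrightarrow> \<forall>f. f \<notin> V \<longrightarrow> r f = 0 \<Longrightarrow> r \<le> m \<Longrightarrow> r = m"
    using minimal_sublinear_exists[OF V Q(1,4)] by blast
  have "linear_on V m" by (rule minimal_sublinear_linear[OF V m(1,2,4)])
  moreover have "m f \<le> Q f" for f using m(3) by (rule le_funD)
  then have "\<forall>f\<in>V. m f \<le> q f" "\<forall>h s. (h, s) \<in> G \<longrightarrow> m h \<le> s"
    using Q(2,3) order_trans by blast+
  ultimately show ?thesis by blast
qed

section \<open>A regular measure from a finitely additive set function\<close>

lemma disjoint_compact_separation:
  fixes K L :: "'a::t2_space set"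
  assumes "compact K" "compact L" "K \<inter> L = {}"
  shows "\<exists>U V. open U \<and> open V \<and> K \<subseteq> U \<and> L \<subseteq> V \<and> U \<inter> V = {}"
proof -
  have "Hausdorff_space (euclidean :: 'a topology)"
    by (simp add: Hausdorff_space_def disjnt_def separation_t2)
  then show ?thesis
    using assms by (fastforce simp: Hausdorff_space_compact_sets disjnt_def)
qed

lemma compact_cover_split:
  fixes K :: "'a::t2_space set"
  assumes "compact K" "open U" "open V" "K \<subseteq> U \<union> V"
  shows "\<exists>A B. compact A \<and> compact B \<and> A \<subseteq> U \<and> B \<subseteq> V \<and> K = A \<union> B"
proof -
  have "compact (K - U)" "compact (K - V)" "(K - U) \<inter> (K - V) = {}"
    using assms by (auto intro: compact_diff)
  then obtain P Q where PQ: "open P" "open Q" "K - U \<subseteq> P" "K - V \<subseteq> Q" "P \<inter> Q = {}"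
    using disjoint_compact_separation by meson
  then show ?thesis
    using assms by (intro exI[of _ "K - P"] exI[of _ "K - Q"]) (auto intro: compact_diff)
qed

text \<open>A finitely additive, nonnegative and finite set function, constrained on Borel sets only.\<close>

locale borel_content =
  fixes lam :: "'a::t2_space set \<Rightarrow> real"
  assumes lam_nonneg: "A \<in> sets borel \<Longrightarrow> 0 \<le> lam A"
    and lam_additive: "A \<in> sets borel \<Longrightarrow> B \<in> sets borel \<Longrightarrow> A \<inter> B = {} \<Longrightarrow>
      lam (A \<union> B) = lam A + lam B"
begin

text \<open>The three successive regularisations: of the set function on compact sets from outside by open
  sets, on open sets from inside by compact sets, and on arbitrary sets from outside by open sets.  They
  are defined for all sets, but meant for the kinds of sets in their names.\<close>

definition compact_value :: "'a set \<Rightarrow> ennreal" where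
  "compact_value K = (INF V\<in>{V. open V \<and> K \<subseteq> V}. ennreal (lam V))"

definition open_value :: "'a set \<Rightarrow> ennreal" where
  "open_value U = (SUP K\<in>{K. compact K \<and> K \<subseteq> U}. compact_value K)"

definition outer_value :: "'a set \<Rightarrow> ennreal" where
  "outer_value A = (INF U\<in>{U. open U \<and> A \<subseteq> U}. open_value U)"

lemma lam_mono: "A \<in> sets borel \<Longrightarrow> B \<in> sets borel \<Longrightarrow> A \<subseteq> B \<Longrightarrow> lam A \<le> lam B"
  using lam_additive[of A "B - A"] lam_nonneg[of "B - A"] by (simp add: Un_absorb1)

lemma lam_empty: "lam {} = 0"
  using lam_additive[of "{}" "{}"] by simp

lemma lam_Un_le:
  assumes A: "A \<in> sets borel" and B: "B \<in> sets borel"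
  shows "lam (A \<union> B) \<le> lam A + lam B"
proof -
  have "lam (A \<union> (B - A)) = lam A + lam (B - A)" using A B by (intro lam_additive) auto
  moreover have "lam (B - A) \<le> lam B" using A B by (intro lam_mono) auto
  ultimately show ?thesis by simp
qed

lemma compact_value_le: "open V \<Longrightarrow> K \<subseteq> V \<Longrightarrow> compact_value K \<le> ennreal (lam V)"
  unfolding compact_value_def by (rule INF_lower) simp

lemma compact_value_finite: "compact_value K < top"
  using compact_value_le[of UNIV K] by (simp add: le_less_trans)

lemma compact_value_Un_le: "compact_value (K \<union> L) \<le> compact_value K + compact_value L"
proof (rule ennreal_le_epsilon)
  fix e :: real assume "0 < e"
  have *: "\<exists>V. open V \<and> K \<subseteq> V \<and> ennreal (lam V) < compact_value K + ennreal (e / 2)" for K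
  proof -
    have "compact_value K < compact_value K + ennreal (e / 2)"
      using \<open>0 < e\<close> compact_value_finite[of K] by simp
    then show ?thesis by (subst (asm) (1) compact_value_def) (auto simp: INF_less_iff)
  qed
  obtain V where V: "open V" "K \<subseteq> V" "ennreal (lam V) < compact_value K + ennreal (e / 2)"
    using * by blast
  obtain W where W: "open W" "L \<subseteq> W" "ennreal (lam W) < compact_value L + ennreal (e / 2)"
    using * by blast
  have "compact_value (K \<union> L) \<le> ennreal (lam (V \<union> W))"
    using V W by (intro compact_value_le) auto
  also have "\<dots> \<le> ennreal (lam V + lam W)"
    using V W by (intro ennreal_leI lam_Un_le) auto
  also have "\<dots> = ennreal (lam V) + ennreal (lam W)"
    using V W by (intro ennreal_plus lam_nonneg) auto
  also have "\<dots> \<le> (compact_value K + ennreal (e / 2)) + (compact_value L + ennreal (e / 2))"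
    using V W by (intro add_mono) auto
  also have "\<dots> = compact_value K + compact_value L + ennreal e"
    using \<open>0 < e\<close> by (simp add: add_ac flip: ennreal_plus)
  finally show "compact_value (K \<union> L) \<le> compact_value K + compact_value L + ennreal e" .
qed

text \<open>Together with the previous lemma, this is additivity on disjoint compact sets, because disjoint
  compact sets have disjoint neighbourhoods.\<close>

lemma compact_value_disjoint:
  assumes "compact K" "compact L" "K \<inter> L = {}"
  shows "compact_value K + compact_value L \<le> compact_value (K \<union> L)"
  unfolding compact_value_def[of "K \<union> L"]
proof (rule INF_greatest)
  fix W assume "W \<in> {V. open V \<and> K \<union> L \<subseteq> V}"
  then have W: "open W" "K \<subseteq> W" "L \<subseteq> W" by auto
  obtain U V where UV: "open U" "open V" "K \<subseteq> U" "L \<subseteq> V" "U \<inter> V = {}"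
    using disjoint_compact_separation[OF assms] by blast
  have "compact_value K + compact_value L \<le> ennreal (lam (W \<inter> U)) + ennreal (lam (W \<inter> V))"
    using UV W by (intro add_mono compact_value_le) auto
  also have "\<dots> = ennreal (lam (W \<inter> U) + lam (W \<inter> V))"
    using UV W by (intro ennreal_plus[symmetric] lam_nonneg) auto
  also have "lam (W \<inter> U) + lam (W \<inter> V) = lam ((W \<inter> U) \<union> (W \<inter> V))"
    using UV W by (intro lam_additive[symmetric]) auto
  also have "ennreal \<dots> \<le> ennreal (lam W)"
    using UV W by (intro ennreal_leI lam_mono) auto
  finally show "compact_value K + compact_value L \<le> ennreal (lam W)" .
qed

lemma compact_value_ge:
  assumes "compact K" shows "ennreal (lam K) \<le> compact_value K"
  unfolding compact_value_def
  using assms by (intro INF_greatest ennreal_leI lam_mono) (auto intro: borel_compact)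

lemma open_value_ge: "compact K \<Longrightarrow> K \<subseteq> U \<Longrightarrow> compact_value K \<le> open_value U"
  unfolding open_value_def by (rule SUP_upper) simp

lemma open_value_mono: "U \<subseteq> V \<Longrightarrow> open_value U \<le> open_value V"
  unfolding open_value_def by (rule SUP_subset_mono) auto

lemma open_value_le: "open U \<Longrightarrow> open_value U \<le> ennreal (lam U)"
  unfolding open_value_def by (intro SUP_least compact_value_le) auto

lemma open_value_finite: "open_value U < top"
  using open_value_mono[of U UNIV] open_value_le[of UNIV]
  by (meson ennreal_less_top le_less_trans open_UNIV subset_UNIV)

lemma open_value_approx:
  assumes "0 < e"
  shows "\<exists>K. compact K \<and> K \<subseteq> U \<and> open_value U < compact_value K + ennreal e"
proof -
  have "\<exists>K\<in>{K. compact K \<and> K \<subseteq> U}. open_value U < compact_value K + ennreal e"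
  proof (rule SUP_approx_ennreal[OF assms])
    show "{K. compact K \<and> K \<subseteq> U} \<noteq> {}" by auto
    show "open_value U = (SUP K\<in>{K. compact K \<and> K \<subseteq> U}. compact_value K)"
      by (rule open_value_def)
    show "open_value U \<noteq> \<infinity>" using open_value_finite[of U] by simp
  qed
  then show ?thesis by blast
qed

lemma open_value_empty: "open_value {} = 0"
  using open_value_le[of "{}"] by (simp add: lam_empty)

lemma compact_value_finite_cover:
  fixes n :: nat
  assumes "compact K" "\<And>i. i < n \<Longrightarrow> open (U i)" "K \<subseteq> (\<Union>i<n. U i)"
  shows "compact_value K \<le> (\<Sum>i<n. open_value (U i))"
  using assms
proof (induction n arbitrary: K)
  case 0
  then show ?case using open_value_ge[of "{}" "{}"] by (simp add: open_value_empty)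
next
  case (Suc n)
  have "K \<subseteq> (\<Union>i<n. U i) \<union> U n" using Suc.prems(3) by (auto simp: lessThan_Suc)
  moreover have "open (\<Union>i<n. U i)" "open (U n)" using Suc.prems(2) by auto
  ultimately obtain A B where AB: "compact A" "compact B" "A \<subseteq> (\<Union>i<n. U i)" "B \<subseteq> U n" "K = A \<union> B"
    using compact_cover_split[OF Suc.prems(1)] by meson
  have "compact_value K \<le> compact_value A + compact_value B"
    unfolding AB(5) by (rule compact_value_Un_le)
  also have "\<dots> \<le> (\<Sum>i<n. open_value (U i)) + open_value (U n)"
    using AB Suc by (intro add_mono Suc.IH open_value_ge) auto
  finally show ?case by simp
qed

lemma open_value_countable_cover:
  assumes U: "\<And>i::nat. open (U i)"
  shows "open_value (\<Union>i. U i) \<le> (\<Sum>i. open_value (U i))"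
  unfolding open_value_def[of "\<Union>i. U i"]
proof (rule SUP_least)
  fix K assume "K \<in> {K. compact K \<and> K \<subseteq> (\<Union>i. U i)}"
  then have K: "compact K" "K \<subseteq> (\<Union>i. U i)" by auto
  then obtain I where I: "finite I" "K \<subseteq> (\<Union>i\<in>I. U i)"
    using U by (meson compactE_image)
  then obtain n where "I \<subseteq> {..<n}" using finite_nat_iff_bounded by blast
  with I have "K \<subseteq> (\<Union>i<n. U i)" by blast
  then have "compact_value K \<le> (\<Sum>i<n. open_value (U i))"
    using K U by (intro compact_value_finite_cover)
  also have "\<dots> \<le> (\<Sum>i. open_value (U i))" by (intro sum_le_suminf) auto
  finally show "compact_value K \<le> (\<Sum>i. open_value (U i))" .
qed

lemma outer_value_le: "open U \<Longrightarrow> A \<subseteq> U \<Longrightarrow> outer_value A \<le> open_value U"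
  unfolding outer_value_def by (rule INF_lower) simp

lemma outer_value_mono: "A \<subseteq> B \<Longrightarrow> outer_value A \<le> outer_value B"
  unfolding outer_value_def by (rule INF_superset_mono) auto

lemma outer_value_open: "open U \<Longrightarrow> outer_value U = open_value U"
  by (rule antisym) (auto simp: outer_value_def intro!: INF_lower INF_greatest open_value_mono)

lemma outer_value_finite: "outer_value A < top"
  using outer_value_le[of UNIV A] open_value_finite[of UNIV] by (simp add: le_less_trans)

lemma outer_value_approx:
  assumes "0 < e"
  shows "\<exists>U. open U \<and> A \<subseteq> U \<and> open_value U < outer_value A + ennreal e"
proof -
  have "outer_value A < outer_value A + ennreal e"
    using assms outer_value_finite[of A] by simp
  then show ?thesis by (subst (asm) (1) outer_value_def) (auto simp: INF_less_iff)
qed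

lemma compact_value_le_outer_value: "compact K \<Longrightarrow> compact_value K \<le> outer_value K"
  unfolding outer_value_def by (auto intro!: INF_greatest open_value_ge)

lemma outer_measure_space_outer_value: "outer_measure_space UNIV outer_value"
  unfolding outer_measure_space_def
proof (intro conjI)
  show "positive UNIV outer_value"
    by (simp add: positive_def outer_value_open open_value_empty)
  show "increasing UNIV outer_value"
    by (simp add: increasing_def outer_value_mono)
  show "countably_subadditive UNIV outer_value"
    unfolding countably_subadditive_def
  proof (intro allI impI)
    fix A :: "nat \<Rightarrow> 'a set"
    show "outer_value (\<Union>i. A i) \<le> (\<Sum>i. outer_value (A i))"
    proof (rule ennreal_le_epsilon)
      fix e :: real assume e: "0 < e"
      have "\<exists>U. open U \<and> A n \<subseteq> U \<and> open_value U < outer_value (A n) + ennreal (e * (1/2)^Suc n)"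
        for n using e by (intro outer_value_approx) simp
      then obtain U where U: "\<And>n. open (U n)" "\<And>n. A n \<subseteq> U n"
        "\<And>n. open_value (U n) < outer_value (A n) + ennreal (e * (1/2)^Suc n)"
        by metis
      have "outer_value (\<Union>i. A i) \<le> open_value (\<Union>i. U i)"
        using U by (intro outer_value_le) auto
      also have "\<dots> \<le> (\<Sum>i. open_value (U i))" by (rule open_value_countable_cover[OF U(1)])
      also have "\<dots> \<le> (\<Sum>n. outer_value (A n) + ennreal (e * (1/2)^Suc n))"
        using U by (intro suminf_le) (auto intro: less_imp_le)
      also have "\<dots> = (\<Sum>n. outer_value (A n)) + (\<Sum>n. ennreal e * ennreal ((1/2) ^ Suc n))"
        using e by (subst suminf_add[symmetric])
          (auto simp del: ennreal_suminf_cmult simp add: ennreal_mult[symmetric])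
      also have "\<dots> = (\<Sum>n. outer_value (A n)) + ennreal e"
        unfolding ennreal_suminf_cmult
        by (subst suminf_ennreal_eq[OF zero_le_power power_half_series]) auto
      finally show "outer_value (\<Union>i. A i) \<le> (\<Sum>i. outer_value (A i)) + ennreal e" .
    qed
  qed
qed

lemma outer_value_Un_le:
  assumes "A \<inter> B = {}" shows "outer_value (A \<union> B) \<le> outer_value A + outer_value B"
proof -
  have "subadditive UNIV outer_value"
    using ring_of_sets.countably_subadditive_subadditive[OF ring_of_sets_Pow, of UNIV outer_value]
      outer_measure_space_outer_value by (simp add: outer_measure_space_def)
  then show ?thesis by (rule subadditiveD) (use assms in auto)
qed

text \<open>Measurability of the open set \<open>U\<close>, tested on open sets \<open>V\<close>: a compact subset \<open>K\<close> of \<open>V \<inter> U\<close> that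
  nearly exhausts it is closed, hence \<open>V - K\<close> is an open set containing \<open>V - U\<close>.\<close>

lemma open_value_split:
  assumes U: "open U" and V: "open V"
  shows "open_value (V \<inter> U) + outer_value (V - U) \<le> open_value V"
proof (rule ennreal_le_epsilon)
  fix e :: real assume e: "0 < e"
  obtain K where K: "compact K" "K \<subseteq> V \<inter> U" "open_value (V \<inter> U) < compact_value K + ennreal e"
    using open_value_approx[OF e] by blast
  have "compact_value K + open_value (V - K) \<le> open_value V"
  proof -
    have "compact_value K + open_value (V - K) =
      (SUP L\<in>{L. compact L \<and> L \<subseteq> V - K}. compact_value K + compact_value L)"
      unfolding open_value_def by (subst ennreal_SUP_add_right) auto
    also have "\<dots> \<le> open_value V"
    proof (rule SUP_least)
      fix L assume "L \<in> {L. compact L \<and> L \<subseteq> V - K}"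
      then have L: "compact L" "L \<subseteq> V - K" by auto
      have "compact_value K + compact_value L \<le> compact_value (K \<union> L)"
        using K L by (intro compact_value_disjoint) auto
      also have "\<dots> \<le> open_value V" using K L by (intro open_value_ge compact_Un) auto
      finally show "compact_value K + compact_value L \<le> open_value V" .
    qed
    finally show ?thesis .
  qed
  moreover have "outer_value (V - U) \<le> open_value (V - K)"
    using K V by (intro outer_value_le open_Diff compact_imp_closed) auto
  ultimately have "compact_value K + outer_value (V - U) \<le> open_value V"
    by (meson add_left_mono order_trans)
  then have le: "compact_value K + outer_value (V - U) + ennreal e \<le> open_value V + ennreal e"
    by (rule add_right_mono)
  have "open_value (V \<inter> U) + outer_value (V - U)
    \<le> compact_value K + ennreal e + outer_value (V - U)"
    using K(3) by (intro add_right_mono less_imp_le)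
  also have "\<dots> = compact_value K + outer_value (V - U) + ennreal e" by (simp only: ac_simps)
  finally show "open_value (V \<inter> U) + outer_value (V - U) \<le> open_value V + ennreal e"
    using le by (rule order_trans)
qed

lemma open_in_lambda_system:
  assumes U: "open U" shows "U \<in> lambda_system UNIV UNIV outer_value"
proof -
  have "outer_value (X \<inter> U) + outer_value (X - U) = outer_value X" for X
  proof (rule antisym)
    show "outer_value (X \<inter> U) + outer_value (X - U) \<le> outer_value X"
      unfolding outer_value_def[of X]
    proof (rule INF_greatest)
      fix V assume "V \<in> {V. open V \<and> X \<subseteq> V}"
      then have V: "open V" "X \<subseteq> V" by auto
      have "outer_value (X \<inter> U) + outer_value (X - U) \<le> open_value (V \<inter> U) + outer_value (V - U)"
        using U V by (intro add_mono outer_value_le outer_value_mono) auto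
      also have "\<dots> \<le> open_value V" by (rule open_value_split[OF U V(1)])
      finally show "outer_value (X \<inter> U) + outer_value (X - U) \<le> open_value V" .
    qed
    have "outer_value ((X \<inter> U) \<union> (X - U)) \<le> outer_value (X \<inter> U) + outer_value (X - U)"
      by (rule outer_value_Un_le) auto
    then show "outer_value X \<le> outer_value (X \<inter> U) + outer_value (X - U)"
      by (simp add: Int_Diff_Un)
  qed
  then show ?thesis
    using algebra.lambda_system_eq[OF algebra_Pow, of UNIV outer_value] by simp
qed

text \<open>The restriction of the outer measure to the Borel sets.\<close>

definition radon :: "'a measure" where
  "radon = measure_of UNIV (sets borel) outer_value"

lemma sets_radon: "sets radon = sets borel"
  unfolding radon_def by (metis sets.sets_measure_of_eq space_borel)

lemma space_radon: "space radon = UNIV"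
  using sets_eq_imp_space_eq[OF sets_radon] by simp

lemma emeasure_radon:
  assumes "A \<in> sets borel" shows "emeasure radon A = outer_value A"
proof -
  have ms: "measure_space UNIV (lambda_system UNIV UNIV outer_value) outer_value"
    using sigma_algebra.caratheodory_lemma[OF sigma_algebra_Pow, of UNIV outer_value]
      outer_measure_space_outer_value by simp
  then have "sigma_algebra UNIV (lambda_system UNIV UNIV outer_value)"
    by (simp add: measure_space_def)
  then have sub: "sets borel \<subseteq> lambda_system UNIV UNIV outer_value"
    unfolding sets_borel
    by (rule sigma_algebra.sigma_sets_subset) (auto intro: open_in_lambda_system)
  have "countably_additive (sets borel) outer_value"
    using ms sub unfolding measure_space_def countably_additive_def by blast
  moreover have "positive (sets borel) outer_value"
    using ms by (simp add: measure_space_def positive_def)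
  moreover have "sigma_algebra UNIV (sets (borel :: 'a measure))"
    using sets.sigma_algebra_axioms[of "borel :: 'a measure"] by simp
  ultimately show ?thesis
    unfolding radon_def using assms by (intro emeasure_measure_of_sigma)
qed

lemma finite_measure_radon: "finite_measure radon"
  using outer_value_finite[of UNIV]
  by (intro finite_measureI) (simp add: space_radon emeasure_radon)

lemma compact_inner_approx_UNIV:
  assumes "0 < e"
  shows "\<exists>K. compact K \<and> measure radon (- K) < e"
proof -
  interpret finite_measure radon by (rule finite_measure_radon)
  obtain K where K: "compact K" "open_value UNIV < compact_value K + ennreal e"
    using open_value_approx[OF assms] by blast
  have "emeasure radon UNIV < emeasure radon K + ennreal e"
  proof -
    have "emeasure radon UNIV = open_value UNIV" by (simp add: emeasure_radon outer_value_open)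
    also have "\<dots> < compact_value K + ennreal e" by (rule K(2))
    also have "\<dots> \<le> emeasure radon K + ennreal e"
      using compact_value_le_outer_value[OF K(1)] K(1)
      by (intro add_right_mono) (simp add: emeasure_radon borel_compact)
    finally show ?thesis .
  qed
  then have "measure radon UNIV < measure radon K + e"
    using assms by (simp add: emeasure_eq_measure ennreal_less_iff flip: ennreal_plus)
  moreover have "measure radon (- K) = measure radon UNIV - measure radon K"
    using finite_measure_compl[of K] K(1)
    by (simp add: sets_radon space_radon borel_compact Compl_eq_Diff_UNIV)
  ultimately show ?thesis using K(1) by (intro exI[of _ K]) simp
qed

lemma radon_inner_approx:
  assumes A: "A \<in> sets borel" and e: "0 < e"
  shows "\<exists>B. closed B \<and> compact B \<and> B \<subseteq> A \<and> measure radon A < measure radon B + e"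
proof -
  interpret finite_measure radon by (rule finite_measure_radon)
  obtain K where K: "compact K" "measure radon (- K) < e / 2"
    using compact_inner_approx_UNIV[of "e / 2"] e by auto
  obtain U where U: "open U" "- A \<subseteq> U" "open_value U < outer_value (- A) + ennreal (e / 2)"
    using outer_value_approx[of "e / 2" "- A"] e by auto
  have "emeasure radon U < emeasure radon (- A) + ennreal (e / 2)"
    using U A by (simp add: emeasure_radon outer_value_open borel_comp)
  then have "measure radon U < measure radon (- A) + e / 2"
    using e by (simp add: emeasure_eq_measure ennreal_less_iff flip: ennreal_plus)
  moreover have "measure radon (U - - A) = measure radon U - measure radon (- A)"
    using U A by (intro finite_measure_Diff) (auto simp: sets_radon borel_comp)
  ultimately have UA: "measure radon (U - - A) < e / 2" by simp
  have [simp]: "U \<in> sets borel" "K \<in> sets borel" "- A \<in> sets borel" "- K \<in> sets borel"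
    using A U K by (simp_all add: borel_comp borel_compact)
  let ?B = "K - U"
  have B: "compact ?B" using K U by (intro compact_diff)
  have UA_borel: "U - - A \<in> sets borel" "U - - A \<union> - K \<in> sets borel" "?B \<in> sets borel"
    by (intro sets.Diff sets.Un; simp)+
  have "measure radon A \<le> measure radon (?B \<union> ((U - - A) \<union> - K))"
    by (intro finite_measure_mono) (use UA_borel in \<open>auto simp only: sets_radon intro: sets.Un\<close>)
  also have "\<dots> \<le> measure radon ?B + measure radon ((U - - A) \<union> - K)"
    by (intro measure_Un_le) (simp_all only: sets_radon UA_borel)
  also have "measure radon ((U - - A) \<union> - K) \<le> measure radon (U - - A) + measure radon (- K)"
    using UA_borel by (intro measure_Un_le) (simp_all add: sets_radon)
  finally have "measure radon A < measure radon ?B + e" using UA K(2) by simp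
  then show ?thesis using B U(2) by (intro exI[of _ ?B]) (auto intro: compact_imp_closed)
qed

lemma radon_in_ca_r_plus: "radon \<in> ca_r_plus"
proof -
  interpret finite_measure radon by (rule finite_measure_radon)
  have "regular_measure radon"
    unfolding regular_measure_def
  proof (intro ballI antisym)
    fix A :: "'a set" assume A: "A \<in> sets borel"
    let ?F = "{B \<in> sets borel. closed B \<and> compact B \<and> B \<subseteq> A}"
    show "(SUP B\<in>?F. emeasure radon B) \<le> emeasure radon A"
      using A by (intro SUP_least emeasure_mono) (auto simp: sets_radon)
    show "emeasure radon A \<le> (SUP B\<in>?F. emeasure radon B)"
    proof (rule ennreal_le_epsilon)
      fix e :: real assume e: "0 < e"
      obtain B where B: "closed B" "compact B" "B \<subseteq> A" "measure radon A < measure radon B + e"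
        using radon_inner_approx[OF A e] by blast
      have "emeasure radon A \<le> emeasure radon B + ennreal e"
        using B(4) e by (simp add: emeasure_eq_measure flip: ennreal_plus)
      also have "\<dots> \<le> (SUP B\<in>?F. emeasure radon B) + ennreal e"
        using B by (intro add_right_mono SUP_upper) auto
      finally show "emeasure radon A \<le> (SUP B\<in>?F. emeasure radon B) + ennreal e" .
    qed
  qed
  then show ?thesis by (simp add: ca_r_plus_def sets_radon finite_measure_radon)
qed

lemma measure_radon_UNIV_le: "measure radon UNIV \<le> lam UNIV"
proof -
  interpret finite_measure radon by (rule finite_measure_radon)
  have "emeasure radon UNIV \<le> ennreal (lam UNIV)"
    using open_value_le[of UNIV] by (simp add: emeasure_radon outer_value_open)
  then show ?thesis by (simp add: emeasure_eq_measure lam_nonneg)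
qed

lemma lam_compact_le:
  assumes "compact K" shows "lam K \<le> measure radon K"
proof -
  interpret finite_measure radon by (rule finite_measure_radon)
  have "ennreal (lam K) \<le> emeasure radon K"
    using compact_value_ge[OF assms] compact_value_le_outer_value[OF assms] assms
    by (auto simp: emeasure_radon borel_compact intro: order_trans)
  then show ?thesis by (simp add: emeasure_eq_measure)
qed

text \<open>Tightness reduces closed sets to compact ones, where the first regularisation can only increase
  the value.\<close>

lemma lam_closed_le:
  assumes tight: "\<And>e. 0 < e \<Longrightarrow> \<exists>K. compact K \<and> lam (- K) \<le> e"
    and F: "closed F"
  shows "lam F \<le> measure radon F"
proof (rule field_le_epsilon)
  interpret finite_measure radon by (rule finite_measure_radon)
  fix e :: real assume "0 < e"
  then obtain K where K: "compact K" "lam (- K) \<le> e" using tight by blast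
  have FK: "compact (F \<inter> K)" using F K by (intro closed_Int_compact)
  have "lam F \<le> lam ((F \<inter> K) \<union> - K)"
    using F K FK by (intro lam_mono) (auto simp: borel_comp borel_compact)
  also have "\<dots> = lam (F \<inter> K) + lam (- K)"
    using K FK by (intro lam_additive) (auto simp: borel_comp borel_compact)
  also have "\<dots> \<le> measure radon F + e"
  proof (intro add_mono K(2))
    have "lam (F \<inter> K) \<le> measure radon (F \<inter> K)" by (rule lam_compact_le[OF FK])
    also have "\<dots> \<le> measure radon F"
      using F FK by (intro finite_measure_mono) (auto simp: sets_radon)
    finally show "lam (F \<inter> K) \<le> measure radon F" .
  qed
  finally show "lam F \<le> measure radon F + e" .
qed

end

section \<open>Semicontinuous functions and integrals\<close>

lemma function_space_B_b: "function_space (B_b :: ('a::topological_space \<Rightarrow> real) set)"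
proof -
  have "(\<lambda>x. f x + g x) \<in> B_b" if "f \<in> B_b" "g \<in> B_b" for f g :: "'a \<Rightarrow> real"
    using that by (auto simp: B_b_def intro!: bounded_plus_comp)
  moreover have "(\<lambda>x. a * f x) \<in> B_b" if "f \<in> B_b" for a and f :: "'a \<Rightarrow> real"
    using that bounded_scaling[of "range f" a] by (auto simp: B_b_def image_image)
  moreover have "(\<lambda>x. 0) \<in> (B_b :: ('a \<Rightarrow> real) set)" by (simp add: B_b_def)
  ultimately show ?thesis unfolding function_space_def by blast
qed

lemmas B_b_add = function_space_add[OF function_space_B_b]
  and B_b_diff = function_space_diff[OF function_space_B_b]
  and B_b_scale = function_space_scale[OF function_space_B_b]

lemma B_b_const: "(\<lambda>x. c) \<in> B_b"
  by (simp add: B_b_def)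

lemma B_b_indicator: "A \<in> sets borel \<Longrightarrow> indicator A \<in> B_b"
  by (auto simp: B_b_def bounded_iff indicator_def intro!: exI[of _ 1])

lemma B_b_sum:
  assumes "\<And>i. i \<in> I \<Longrightarrow> f i \<in> B_b" shows "(\<lambda>x. \<Sum>i\<in>I. f i x) \<in> B_b"
  using assms
  by (induction I rule: infinite_finite_induct) (auto intro: B_b_const B_b_add)

lemma B_b_bound:
  assumes "f \<in> B_b" obtains b where "0 \<le> b" "\<And>x. \<bar>f x\<bar> \<le> b"
proof -
  obtain b where "\<And>x. \<bar>f x\<bar> \<le> b" using assms by (auto simp: B_b_def bounded_iff)
  moreover from this have "0 \<le> b" by (meson abs_ge_zero order_trans)
  ultimately show ?thesis using that by blast
qed

lemma linear_on_B_b_sum: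
  assumes L: "linear_on B_b L" and f: "\<And>i. i \<in> I \<Longrightarrow> f i \<in> B_b"
  shows "L (\<lambda>x. \<Sum>i\<in>I. f i x) = (\<Sum>i\<in>I. L (f i))"
proof -
  have "L (\<lambda>x. 0) = 0" using linear_on_scale[OF L B_b_const, of 0 0] by simp
  then show ?thesis
    using f
    by (induction I rule: infinite_finite_induct) (auto simp: linear_on_add[OF L] B_b_sum)
qed

lemma usc_add:
  assumes f: "upper_semicontinuous f" and g: "upper_semicontinuous g"
  shows "upper_semicontinuous (\<lambda>x. f x + g x)"
  unfolding upper_semicontinuous_def
proof
  fix c :: real
  have "{x. f x + g x < c} = (\<Union>r. {x. f x < r} \<inter> {x. g x < c - r})"
  proof (intro equalityI subsetI)
    fix x assume "x \<in> {x. f x + g x < c}"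
    then have "f x < (f x + c - g x) / 2" "g x < c - (f x + c - g x) / 2"
      by (simp_all add: field_simps)
    then show "x \<in> (\<Union>r. {x. f x < r} \<inter> {x. g x < c - r})" by blast
  qed auto
  also have "open \<dots>" using f g by (auto simp: upper_semicontinuous_def)
  finally show "open {x. f x + g x < c}" .
qed

lemma usc_const: "upper_semicontinuous (\<lambda>x. c)"
  by (simp add: upper_semicontinuous_def)

lemma usc_sum:
  assumes "\<And>i. i \<in> I \<Longrightarrow> upper_semicontinuous (f i)"
  shows "upper_semicontinuous (\<lambda>x. \<Sum>i\<in>I. f i x)"
  using assms by (induction I rule: infinite_finite_induct) (auto intro: usc_const usc_add)

lemma usc_scaled_indicator:
  assumes "closed F" "0 \<le> d" shows "upper_semicontinuous (\<lambda>x. d * indicator F x)"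
  unfolding upper_semicontinuous_def
proof
  fix c :: real
  have "{x. d * indicator F x < c} = (if c \<le> 0 then {} else if d < c then UNIV else - F)"
    using assms(2) by (auto simp: indicator_def)
  then show "open {x. d * indicator F x < c}" using assms(1) by (simp add: open_Compl)
qed

lemma U_b_subset_B_b: "U_b \<subseteq> B_b"
proof
  fix f :: "'a \<Rightarrow> real" assume f: "f \<in> U_b"
  have "{x. f x < c} \<in> sets borel" for c
    using f by (intro borel_open) (simp add: U_b_def upper_semicontinuous_def)
  then have "f \<in> borel_measurable borel"
    by (intro borel_measurable_iff_less[THEN iffD2] allI) simp
  then show "f \<in> B_b" using f by (simp add: B_b_def U_b_def)
qed

lemma C_b_subset_U_b: "C_b \<subseteq> U_b"
  unfolding C_b_def U_b_def upper_semicontinuous_def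
  by (intro Collect_mono) (simp add: open_Collect_less)

lemma C_b_minus: "f \<in> C_b \<Longrightarrow> (\<lambda>x. - f x) \<in> C_b"
  using bounded_scaling[of "range f" "-1"] by (auto simp: C_b_def image_image intro: continuous_on_minus)

lemma closed_superlevel:
  assumes "upper_semicontinuous f" shows "closed {x. t \<le> f x}"
proof -
  have "{x. t \<le> f x} = - {x. f x < t}" by auto
  then show ?thesis using assms by (simp add: upper_semicontinuous_def closed_Compl)
qed

text \<open>The step function counts the multiples of \<open>e\<close> up to \<open>f x + b\<close>, in the form of indicators of
  superlevel sets; these are closed if \<open>f\<close> is upper semicontinuous.\<close>

lemma step_approximation:
  fixes f :: "'a \<Rightarrow> real"
  assumes bound: "\<And>x. \<bar>f x\<bar> \<le> b" and e: "0 < e"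
  shows "\<exists>n t. \<forall>x. - b + e * (\<Sum>i<n. indicator {y. t i \<le> f y} x) \<le> f x \<and>
    f x \<le> - b + e * (\<Sum>i<n::nat. indicator {y. t i \<le> f y} x) + e"
proof -
  obtain n :: nat where n: "2 * b / e < n" using reals_Archimedean2 by blast
  define t where "t i = - b + e * real (Suc i)" for i
  have "- b + e * (\<Sum>i<n. indicator {y. t i \<le> f y} x) \<le> f x \<and>
    f x \<le> - b + e * (\<Sum>i<n. indicator {y. t i \<le> f y} x) + e" for x
  proof -
    define y where "y = (f x + b) / e"
    have fx: "f x = - b + e * y" using e by (simp add: y_def)
    have y0: "0 \<le> y" using bound[of x] e by (simp add: y_def)
    have "y \<le> 2 * b / e" using bound[of x] e by (simp add: y_def divide_right_mono)
    define k where "k = nat \<lfloor>y\<rfloor>"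
    have k: "real k \<le> y" "y < real k + 1" using y0 unfolding k_def by linarith+
    have kn: "k \<le> n" using \<open>y \<le> 2 * b / e\<close> n k by linarith
    have less: "t i \<le> f x \<longleftrightarrow> i < k" for i
    proof -
      have "t i \<le> f x \<longleftrightarrow> real (Suc i) \<le> y" using e by (simp add: t_def fx)
      also have "\<dots> \<longleftrightarrow> i < k" using k by linarith
      finally show ?thesis .
    qed
    have "(\<Sum>i<n. indicator {y. t i \<le> f y} x) = (\<Sum>i<k. 1 :: real)"
      using kn by (intro sum.mono_neutral_cong_right) (auto simp: less indicator_def)
    then have "(\<Sum>i<n. indicator {y. t i \<le> f y} x) = real k" by simp
    moreover have "e * real k \<le> e * y" "e * y \<le> e * (real k + 1)"
      using e k by simp_all
    ultimately show ?thesis by (simp add: fx distrib_left)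
  qed
  then show ?thesis by blast
qed

lemma ca_r_plusD:
  assumes "\<mu> \<in> ca_r_plus"
  shows "sets \<mu> = sets borel" "space \<mu> = UNIV" "finite_measure \<mu>" "regular_measure \<mu>"
  using assms sets_eq_imp_space_eq[of \<mu> borel] by (auto simp: ca_r_plus_def)

lemma B_b_integrable:
  assumes \<mu>: "\<mu> \<in> ca_r_plus" and f: "f \<in> B_b" shows "integrable \<mu> f"
proof -
  interpret finite_measure \<mu> by (rule ca_r_plusD[OF \<mu>])
  obtain b where "\<And>x. \<bar>f x\<bar> \<le> b" using B_b_bound[OF f] by blast
  moreover have "f \<in> borel_measurable \<mu>"
    using f by (simp add: B_b_def measurable_cong_sets[OF ca_r_plusD(1)[OF \<mu>] refl])
  ultimately show ?thesis by (intro integrable_const_bound[of _ b]) auto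
qed

lemma integral_step:
  assumes \<mu>: "\<mu> \<in> ca_r_plus" and A: "\<And>i. i < n \<Longrightarrow> A i \<in> sets borel"
  shows "(\<integral>x. c + d * (\<Sum>i<n::nat. indicator (A i) x) \<partial>\<mu>)
    = c * measure \<mu> UNIV + d * (\<Sum>i<n. measure \<mu> (A i))"
proof -
  have int: "integrable \<mu> (indicator (A i) :: 'a \<Rightarrow> real)" if "i < n" for i
    using A[OF that] by (intro B_b_integrable[OF \<mu>] B_b_indicator)
  have ints: "integrable \<mu> (\<lambda>x. \<Sum>i<n. indicator (A i) x :: real)"
    using int by (intro Bochner_Integration.integrable_sum) simp
  have "integrable \<mu> (\<lambda>x. c)" by (rule B_b_integrable[OF \<mu> B_b_const])
  then have "(\<integral>x. c + d * (\<Sum>i<n. indicator (A i) x) \<partial>\<mu>)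
    = (\<integral>x. c \<partial>\<mu>) + d * (\<integral>x. (\<Sum>i<n. indicator (A i) x) \<partial>\<mu>)"
    using ints by (subst Bochner_Integration.integral_add) auto
  also have "(\<integral>x. (\<Sum>i<n. indicator (A i) x) \<partial>\<mu>) = (\<Sum>i<n. measure \<mu> (A i))"
    using int by (subst Bochner_Integration.integral_sum) (auto simp: ca_r_plusD[OF \<mu>])
  finally show ?thesis by (simp add: ca_r_plusD[OF \<mu>])
qed

lemma step_in_B_b:
  "(\<And>i. i < n \<Longrightarrow> A i \<in> sets borel) \<Longrightarrow> (\<lambda>x. c + d * (\<Sum>i<n::nat. indicator (A i) x)) \<in> B_b"
  by (intro B_b_add B_b_const B_b_scale B_b_sum B_b_indicator) auto

lemma step_in_U_b:
  assumes "\<And>i. i < n \<Longrightarrow> closed (F i)" "0 \<le> d"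
  shows "(\<lambda>x. c + d * (\<Sum>i<n::nat. indicator (F i) x)) \<in> U_b"
proof -
  have "upper_semicontinuous (\<lambda>x. c + (\<Sum>i<n. d * indicator (F i) x))"
    using assms by (intro usc_add usc_const usc_sum usc_scaled_indicator) auto
  moreover have "(\<lambda>x. c + d * (\<Sum>i<n. indicator (F i) x)) \<in> B_b"
    using assms by (intro step_in_B_b) auto
  moreover have "(\<lambda>x. c + (\<Sum>i<n. d * indicator (F i) x)) =
      (\<lambda>x. c + d * (\<Sum>i<n. indicator (F i) x))"
    by (simp only: sum_distrib_left)
  ultimately show ?thesis unfolding U_b_def B_b_def by simp
qed

lemma integral_inner_approx:
  assumes \<mu>: "\<mu> \<in> ca_r_plus" and f: "f \<in> B_b" and e: "0 < e"
  shows "\<exists>g\<in>U_b. g \<le> f \<and> integral\<^sup>L \<mu> f \<le> integral\<^sup>L \<mu> g + e"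
proof -
  interpret finite_measure \<mu> by (rule ca_r_plusD[OF \<mu>])
  obtain b where b: "\<And>x. \<bar>f x\<bar> \<le> b" using B_b_bound[OF f] by blast
  define m where "m = measure \<mu> UNIV"
  have m: "0 \<le> m" by (simp add: m_def)
  \<comment> \<open>Half of \<open>e\<close> pays for the step approximation with height \<open>d\<close>, and half for replacing each of the
    \<open>n\<close> superlevel sets by a closed subset at a cost of \<open>r\<close>.\<close>
  define d where "d = e / (2 * (m + 1))"
  have d: "0 < d" using e m by (simp add: d_def)
  obtain n t where nt: "\<And>x. - b + d * (\<Sum>i<n. indicator {y. t i \<le> f y} x) \<le> f x"
    "\<And>x. f x \<le> - b + d * (\<Sum>i<n::nat. indicator {y. t i \<le> f y} x) + d"
    using step_approximation[where f = f, OF b d] by blast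
  define A where "A i = {y. t i \<le> f y}" for i
  have A: "A i \<in> sets borel" for i
    using f borel_measurable_le[of "\<lambda>x. t i" borel f] by (simp add: A_def B_b_def)
  define r where "r = e / (2 * (d * n + 1))"
  have dn: "0 < d * n + 1" using d by (simp add: add_nonneg_pos)
  then have r: "0 < r" using e unfolding r_def by (intro divide_pos_pos) simp_all
  have "\<exists>F. closed F \<and> F \<subseteq> A i \<and> measure \<mu> (A i) \<le> measure \<mu> F + r" for i
  proof -
    let ?C = "{B \<in> sets borel. closed B \<and> compact B \<and> B \<subseteq> A i}"
    have "emeasure \<mu> (A i) = (SUP B\<in>?C. emeasure \<mu> B)"
      using ca_r_plusD(4)[OF \<mu>] A by (simp add: regular_measure_def)
    moreover have "?C \<noteq> {}" by auto
    moreover have "emeasure \<mu> (A i) \<noteq> \<infinity>" by simp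
    ultimately have "\<exists>B\<in>?C. emeasure \<mu> (A i) < emeasure \<mu> B + ennreal r"
      by (intro SUP_approx_ennreal[OF r])
    then obtain B where B: "closed B" "B \<subseteq> A i" "emeasure \<mu> (A i) < emeasure \<mu> B + ennreal r"
      by blast
    have "measure \<mu> (A i) < measure \<mu> B + r"
      using B(3) r by (simp add: emeasure_eq_measure ennreal_less_iff flip: ennreal_plus)
    then show ?thesis using B by (intro exI[of _ B]) simp
  qed
  then obtain F where F: "\<And>i. closed (F i)" "\<And>i. F i \<subseteq> A i"
    "\<And>i. measure \<mu> (A i) \<le> measure \<mu> (F i) + r" by metis
  define g where "g = (\<lambda>x. - b + d * (\<Sum>i<n. indicator (F i) x))"
  have gU: "g \<in> U_b" unfolding g_def using F d by (intro step_in_U_b) auto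
  have "g \<le> f"
  proof (rule le_funI)
    fix x
    have "(\<Sum>i<n. indicator (F i) x) \<le> (\<Sum>i<n. indicator (A i) x :: real)"
      using F(2) by (intro sum_mono) (auto simp: indicator_def)
    then have "g x \<le> - b + d * (\<Sum>i<n. indicator (A i) x)" using d by (simp add: g_def)
    also have "\<dots> \<le> f x" using nt(1)[of x] by (simp add: A_def)
    finally show "g x \<le> f x" .
  qed
  moreover have "integral\<^sup>L \<mu> f \<le> integral\<^sup>L \<mu> g + e"
  proof -
    have "integral\<^sup>L \<mu> f \<le> (\<integral>x. (- b + d) + d * (\<Sum>i<n. indicator (A i) x) \<partial>\<mu>)"
      using nt(2) A by (intro integral_mono B_b_integrable[OF \<mu>] step_in_B_b f)
        (auto simp: A_def algebra_simps)
    also have "\<dots> = (- b + d) * m + d * (\<Sum>i<n. measure \<mu> (A i))"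
      using A by (subst integral_step[OF \<mu>]) (auto simp: m_def)
    also have "\<dots> \<le> (- b + d) * m + d * (\<Sum>i<n. measure \<mu> (F i) + r)"
      using F(3) d by (intro add_left_mono mult_left_mono sum_mono) auto
    also have "\<dots> = (- b * m + d * (\<Sum>i<n. measure \<mu> (F i))) + (d * m + d * n * r)"
      by (simp add: sum.distrib algebra_simps)
    also have "- b * m + d * (\<Sum>i<n. measure \<mu> (F i)) = integral\<^sup>L \<mu> g"
      unfolding g_def using F(1) by (subst integral_step[OF \<mu>]) (auto simp: m_def)
    also have "d * m + d * n * r \<le> e / 2 + e / 2"
    proof (rule add_mono)
      show "d * m \<le> e / 2" using e m by (simp add: d_def field_simps)
      have "d * n * r = (d * n / (d * n + 1)) * (e / 2)" using dn by (simp add: r_def field_simps)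
      also have "\<dots> \<le> 1 * (e / 2)" using dn e by (intro mult_right_mono) simp_all
      finally show "d * n * r \<le> e / 2" by simp
    qed
    finally show ?thesis by simp
  qed
  ultimately show ?thesis using gU by blast
qed

text \<open>The measure and the functional have the same total mass and the measure is larger on closed
  sets; the bounds for upper semicontinuous functions follow by writing their step approximations with
  closed superlevel sets.\<close>

theorem measure_dominating_functional:
  fixes L :: "('a::t2_space \<Rightarrow> real) \<Rightarrow> real"
  assumes L: "linear_on B_b L" and mono: "\<And>f g. f \<in> B_b \<Longrightarrow> g \<in> B_b \<Longrightarrow> f \<le> g \<Longrightarrow> L f \<le> L g"
    and tight: "\<And>e. 0 < e \<Longrightarrow> \<exists>K. compact K \<and> L (indicator (- K)) \<le> e"
  shows "\<exists>\<mu>\<in>ca_r_plus. \<forall>f\<in>U_b. L f \<le> integral\<^sup>L \<mu> f"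
proof -
  have L0: "L (\<lambda>x. 0) = 0" using linear_on_scale[OF L B_b_const, of 0 0] by simp
  interpret borel_content "\<lambda>A. L (indicator A)"
  proof
    fix A B :: "'a set" assume A: "A \<in> sets borel"
    show "0 \<le> L (indicator A)"
      using mono[of "\<lambda>x. 0" "indicator A"] A L0 by (auto simp: B_b_const B_b_indicator le_fun_def)
    assume B: "B \<in> sets borel" and "A \<inter> B = {}"
    then have "indicator (A \<union> B) = (\<lambda>x. indicator A x + indicator B x :: real)"
      by (auto simp: indicator_def fun_eq_iff)
    then show "L (indicator (A \<union> B)) = L (indicator A) + L (indicator B)"
      using A B by (simp add: linear_on_add[OF L] B_b_indicator)
  qed
  have \<mu>: "radon \<in> ca_r_plus" by (rule radon_in_ca_r_plus)
  have closed_le: "L (indicator F) \<le> measure radon F" if "closed F" for F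
    using tight that by (rule lam_closed_le)
  have one: "L (\<lambda>x. 1) = measure radon UNIV"
    using closed_le[of UNIV] measure_radon_UNIV_le by (simp add: indicator_def[abs_def])
  have const: "L (\<lambda>x. c) = c * measure radon UNIV" for c
    using linear_on_scale[OF L B_b_const, of c 1] one by simp
  have "L f \<le> integral\<^sup>L radon f" if f: "f \<in> U_b" for f
  proof -
    have fB: "f \<in> B_b" using f U_b_subset_B_b by blast
    obtain b where b: "\<And>x. \<bar>f x\<bar> \<le> b" using B_b_bound[OF fB] by blast
    have le: "L f \<le> integral\<^sup>L radon f + d * measure radon UNIV" if d: "0 < d" for d
    proof -
      obtain n t where nt: "\<And>x. - b + d * (\<Sum>i<n. indicator {y. t i \<le> f y} x) \<le> f x"
        "\<And>x. f x \<le> - b + d * (\<Sum>i<n::nat. indicator {y. t i \<le> f y} x) + d"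
        using step_approximation[where f = f, OF b d] by blast
      define A where "A i = {y. t i \<le> f y}" for i
      have A: "closed (A i)" for i
        using f by (simp add: A_def U_b_def closed_superlevel)
      have AB: "indicator (A i) \<in> B_b" for i using A by (intro B_b_indicator) auto
      have SB: "(\<lambda>x. \<Sum>i<n. indicator (A i) x) \<in> B_b" using AB by (intro B_b_sum) auto
      have "L f \<le> L (\<lambda>x. (- b + d) + d * (\<Sum>i<n. indicator (A i) x))"
        using nt(2) A by (intro mono fB step_in_B_b) (auto simp: le_fun_def A_def algebra_simps)
      also have "\<dots> = (- b + d) * measure radon UNIV + d * (\<Sum>i<n. L (indicator (A i)))"
        using linear_on_add[OF L B_b_const B_b_scale[OF SB]] linear_on_scale[OF L SB]
          linear_on_B_b_sum[OF L, of "{..<n}" "\<lambda>i. indicator (A i)"] AB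
        by (simp add: const)
      also have "\<dots> \<le> (- b + d) * measure radon UNIV + d * (\<Sum>i<n. measure radon (A i))"
        using closed_le A d by (intro add_left_mono mult_left_mono sum_mono) auto
      also have "\<dots> = (\<integral>x. - b + d * (\<Sum>i<n. indicator (A i) x) \<partial>radon) + d * measure radon UNIV"
        using A by (subst integral_step[OF \<mu>]) (auto simp: algebra_simps)
      also have "(\<integral>x. - b + d * (\<Sum>i<n. indicator (A i) x) \<partial>radon) \<le> integral\<^sup>L radon f"
        using nt(1) A by (intro integral_mono B_b_integrable[OF \<mu>] step_in_B_b fB)
          (auto simp: A_def)
      finally show ?thesis by simp
    qed
    show ?thesis
    proof (rule field_le_epsilon)
      fix e :: real assume e: "0 < e"
      define m where "m = measure radon (UNIV :: 'a set)"
      have m: "0 \<le> m" by (simp add: m_def)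
      have "L f \<le> integral\<^sup>L radon f + e / (m + 1) * m"
        using le[of "e / (m + 1)"] e m unfolding m_def[symmetric] by simp
      also have "e / (m + 1) * m \<le> e" using e m by (simp add: field_simps)
      finally show "L f \<le> integral\<^sup>L radon f + e" by simp
    qed
  qed
  with \<mu> show ?thesis by blast
qed

section \<open>Gauges of weights that vanish along the compact sets\<close>

text \<open>Bounded nonnegative functions that tend to zero along the complements of the \<open>K n\<close>.  No
  measurability is needed, as weights enter only through suprema.\<close>

definition vanishing_weight :: "(nat \<Rightarrow> 'a set) \<Rightarrow> ('a \<Rightarrow> real) \<Rightarrow> bool" where
  "vanishing_weight K w \<longleftrightarrow> (\<forall>x. 0 \<le> w x) \<and> (\<exists>b. \<forall>x. w x \<le> b) \<and>
     (\<forall>d>0. \<exists>n. \<forall>x. x \<notin> K n \<longrightarrow> w x \<le> d)"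

text \<open>The Minkowski functional of \<open>{h. \<forall>x. w x * h x \<le> 1}\<close>; the supremum is a genuine one for bounded
  \<open>h\<close> and bounded \<open>w\<close>.\<close>

definition gauge_of :: "('a \<Rightarrow> real) \<Rightarrow> ('a \<Rightarrow> real) \<Rightarrow> real" where
  "gauge_of w h = (SUP x. max 0 (w x * h x))"

lemma vanishing_weight_add:
  assumes K: "incseq K" and v: "vanishing_weight K v" and w: "vanishing_weight K w"
  shows "vanishing_weight K (\<lambda>x. v x + w x)"
  unfolding vanishing_weight_def
proof (intro conjI allI impI)
  show "0 \<le> v x + w x" for x using v w by (simp add: vanishing_weight_def)
  obtain a b where "\<And>x. v x \<le> a" "\<And>x. w x \<le> b" using v w by (auto simp: vanishing_weight_def)
  then show "\<exists>b. \<forall>x. v x + w x \<le> b" by (intro exI[of _ "a + b"]) (simp add: add_mono)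
  fix d :: real assume "0 < d"
  then have d2: "0 < d / 2" by simp
  obtain m where m: "\<And>x. x \<notin> K m \<Longrightarrow> v x \<le> d / 2"
    using v d2 unfolding vanishing_weight_def by blast
  obtain n where n: "\<And>x. x \<notin> K n \<Longrightarrow> w x \<le> d / 2"
    using w d2 unfolding vanishing_weight_def by blast
  have sub: "K m \<subseteq> K (max m n)" "K n \<subseteq> K (max m n)" using incseqD[OF K] by simp_all
  have "v x + w x \<le> d" if "x \<notin> K (max m n)" for x
  proof -
    have "v x \<le> d / 2" "w x \<le> d / 2" using m n sub that by blast+
    then show ?thesis by simp
  qed
  then show "\<exists>n. \<forall>x. x \<notin> K n \<longrightarrow> v x + w x \<le> d" by blast
qed

lemma vanishing_weight_scale:
  assumes w: "vanishing_weight K w" and k: "0 < k"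
  shows "vanishing_weight K (\<lambda>x. k * w x)"
  unfolding vanishing_weight_def
proof (intro conjI allI impI)
  show "0 \<le> k * w x" for x using w k by (simp add: vanishing_weight_def)
  obtain b where "\<And>x. w x \<le> b" using w by (auto simp: vanishing_weight_def)
  then show "\<exists>b. \<forall>x. k * w x \<le> b" using k by (intro exI[of _ "k * b"]) simp
  fix d :: real assume "0 < d"
  then have "0 < d / k" using k by simp
  then obtain n where "\<And>x. x \<notin> K n \<Longrightarrow> w x \<le> d / k"
    using w unfolding vanishing_weight_def by blast
  then show "\<exists>n. \<forall>x. x \<notin> K n \<longrightarrow> k * w x \<le> d"
    using k by (intro exI[of _ n]) (simp add: pos_le_divide_eq mult.commute)
qed

lemma gauge_of_bdd:
  assumes w: "vanishing_weight K w" and h: "h \<in> B_b"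
  shows "bdd_above (range (\<lambda>x. max 0 (w x * h x)))"
proof -
  obtain b where b: "0 \<le> b" "\<And>x. \<bar>h x\<bar> \<le> b" using B_b_bound[OF h] by blast
  obtain a where a: "\<And>x. w x \<le> a" and w0: "\<And>x. 0 \<le> w x"
    using w by (auto simp: vanishing_weight_def)
  have "max 0 (w x * h x) \<le> a * b" for x
  proof -
    have "w x * h x \<le> w x * b" using b(2)[of x] w0[of x] by (intro mult_left_mono) auto
    also have "\<dots> \<le> a * b" using a b by (intro mult_right_mono) auto
    moreover have "0 \<le> a * b" using order_trans[OF w0[of x] a[of x]] b by simp
    ultimately show ?thesis by simp
  qed
  then show ?thesis by (intro bdd_aboveI2)
qed

lemma gauge_of_upper:
  assumes "vanishing_weight K w" "h \<in> B_b"
  shows "w x * h x \<le> gauge_of w h" "0 \<le> gauge_of w h"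
proof -
  have "max 0 (w y * h y) \<le> gauge_of w h" for y
    unfolding gauge_of_def by (intro cSUP_upper gauge_of_bdd[OF assms] UNIV_I)
  from this[of x] show "w x * h x \<le> gauge_of w h" "0 \<le> gauge_of w h" by simp_all
qed

lemma gauge_of_least: "0 \<le> t \<Longrightarrow> (\<And>x. w x * h x \<le> t) \<Longrightarrow> gauge_of w h \<le> t"
  unfolding gauge_of_def by (intro cSUP_least) auto

lemma gauge_of_weight_mono:
  assumes w: "vanishing_weight K w" and h: "h \<in> B_b" and "\<And>x. 0 \<le> v x" "\<And>x. v x \<le> w x"
  shows "gauge_of v h \<le> gauge_of w h"
proof (rule gauge_of_least)
  show "0 \<le> gauge_of w h" by (rule gauge_of_upper[OF w h])
  fix x
  show "v x * h x \<le> gauge_of w h"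
  proof (cases "0 \<le> h x")
    case True
    then have "v x * h x \<le> w x * h x" using assms by (intro mult_right_mono)
    then show ?thesis using gauge_of_upper(1)[OF w h, of x] by simp
  next
    case False
    then have "v x * h x \<le> 0" using assms(3)[of x] by (simp add: mult_nonneg_nonpos)
    then show ?thesis using gauge_of_upper(2)[OF w h] by simp
  qed
qed

lemma sublinear_gauge_of:
  assumes w: "vanishing_weight K w" shows "sublinear_on B_b (gauge_of w)"
proof (rule sublinear_onI[OF function_space_B_b])
  note upper = gauge_of_upper[OF w]
  show "gauge_of w (\<lambda>x. f x + g x) \<le> gauge_of w f + gauge_of w g"
    if "f \<in> B_b" "g \<in> B_b" for f g
    using upper[OF that(1)] upper[OF that(2)]
    by (intro gauge_of_least) (auto simp: distrib_left intro: add_mono)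
  show "gauge_of w (\<lambda>x. a * f x) \<le> a * gauge_of w f" if a: "0 < a" and f: "f \<in> B_b" for a f
  proof (rule gauge_of_least)
    show "0 \<le> a * gauge_of w f" using upper(2)[OF f] a by simp
    fix x
    have "a * (w x * f x) \<le> a * gauge_of w f" using upper(1)[OF f] a by simp
    then show "w x * (a * f x) \<le> a * gauge_of w f" by (simp add: ac_simps)
  qed
  show "gauge_of w (\<lambda>x. 0) \<le> 0" by (rule gauge_of_least) auto
qed

section \<open>Lower bounds for the functional\<close>

lemma increasing_convexD:
  assumes "increasing_convex \<phi>"
  shows "f \<in> B_b \<Longrightarrow> g \<in> B_b \<Longrightarrow> 0 < t \<Longrightarrow> t < 1 \<Longrightarrow>
      \<phi> (\<lambda>x. t * f x + (1 - t) * g x) \<le> ereal t * \<phi> f + ereal (1 - t) * \<phi> g"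
    and "f \<in> B_b \<Longrightarrow> g \<in> B_b \<Longrightarrow> g \<le> f \<Longrightarrow> \<phi> g \<le> \<phi> f"
  using assms by (auto simp: increasing_convex_def)

text \<open>What the argument uses besides convexity and monotonicity, and what each of the conditions (C)
  and (D) implies: continuity along
  increasing sequences that become stationary on each \<open>K m\<close>, and lower semicontinuity along the
  constants.\<close>

locale tight_functional =
  fixes \<phi> :: "('a::t2_space \<Rightarrow> real) \<Rightarrow> ereal" and K :: "nat \<Rightarrow> 'a set"
  assumes proper: "f \<in> B_b \<Longrightarrow> \<phi> f \<noteq> -\<infinity>"
    and convex: "increasing_convex \<phi>"
    and K_incseq: "incseq K" and K_compact: "compact (K n)"
    and tail: "incseq F \<Longrightarrow> (\<And>n. F n \<in> B_b) \<Longrightarrow> f \<in> B_b \<Longrightarrow>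
      (\<And>m n x. m \<le> n \<Longrightarrow> x \<in> K m \<Longrightarrow> F n x = f x) \<Longrightarrow> (\<lambda>n. \<phi> (F n)) \<longlonglongrightarrow> \<phi> f"
    and shift: "f \<in> B_b \<Longrightarrow> ereal c < \<phi> f \<Longrightarrow> \<exists>e>0. ereal c < \<phi> (\<lambda>x. f x - e)"
begin

lemma K_borel: "- K n \<in> sets borel"
  using K_compact[of n] by (simp add: borel_compact borel_comp)

lemma tail_decrement:
  assumes v: "v \<in> B_b" and c: "ereal c < \<phi> v"
  shows "\<exists>n\<ge>N. ereal c < \<phi> (\<lambda>x. v x - indicator (- K n) x)"
proof -
  have "(\<lambda>n. \<phi> (\<lambda>x. v x - indicator (- K n) x)) \<longlonglongrightarrow> \<phi> v"
  proof (rule tail[OF _ _ v])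
    show "incseq (\<lambda>n x. v x - indicator (- K n) x)"
      using K_incseq by (auto simp: incseq_def le_fun_def indicator_def)
    show "(\<lambda>x. v x - indicator (- K n) x) \<in> B_b" for n
      by (intro B_b_diff v B_b_indicator K_borel)
    show "v x - indicator (- K n) x = v x" if "m \<le> n" "x \<in> K m" for m n x
      using incseqD[OF K_incseq that(1)] that(2) by auto
  qed
  then have "\<forall>\<^sub>F n in sequentially. ereal c < \<phi> (\<lambda>x. v x - indicator (- K n) x)"
    using c by (rule order_tendstoD)
  then have "\<forall>\<^sub>F n in sequentially. N \<le> n \<and> ereal c < \<phi> (\<lambda>x. v x - indicator (- K n) x)"
    by (intro eventually_conj eventually_ge_at_top)
  then show ?thesis unfolding eventually_sequentially by blast
qed

text \<open>Applying the previous lemma to each function it produces; \<open>c\<close> stays a strict lower bound at every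
  finite stage.\<close>

lemma decrement_sequence:
  assumes f: "f \<in> B_b" and c: "ereal c < \<phi> f"
  shows "\<exists>N. incseq N \<and>
    (\<forall>k. ereal c < \<phi> (\<lambda>x. f x - (\<Sum>j<k. indicator (- K (N j)) x)))"
proof -
  \<comment> \<open>States are pairs of an index and the function reached so far; the index of the initial state is
    irrelevant, so \<open>N j\<close> is read off from state \<open>j + 1\<close>.\<close>
  define P where "P i s \<longleftrightarrow> snd s \<in> B_b \<and> ereal c < \<phi> (snd s) \<and> (i = 0 \<longrightarrow> snd s = f)"
    for i :: nat and s :: "nat \<times> ('a \<Rightarrow> real)"
  define Q where "Q i s s' \<longleftrightarrow> fst s \<le> fst s' \<and>
      snd s' = (\<lambda>x. snd s x - indicator (- K (fst s')) x)"
    for i :: nat and s s' :: "nat \<times> ('a \<Rightarrow> real)"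
  have "\<exists>s. \<forall>i. P i (s i) \<and> Q i (s i) (s (Suc i))"
  proof (rule dependent_nat_choice)
    show "\<exists>s. P 0 s" using f c by (auto simp: P_def intro!: exI[of _ "(0, f)"])
    fix s i assume s: "P i s"
    obtain n where n: "fst s \<le> n" "ereal c < \<phi> (\<lambda>x. snd s x - indicator (- K n) x)"
      using tail_decrement[of "snd s" c "fst s"] s by (auto simp: P_def)
    have "(\<lambda>x. snd s x - indicator (- K n) x) \<in> B_b"
      using s by (intro B_b_diff B_b_indicator K_borel) (simp add: P_def)
    with n show "\<exists>s'. P (Suc i) s' \<and> Q i s s'"
      by (intro exI[of _ "(n, \<lambda>x. snd s x - indicator (- K n) x)"]) (simp add: P_def Q_def)
  qed
  then obtain s where P: "\<And>i. P i (s i)" and Q: "\<And>i. Q i (s i) (s (Suc i))" by blast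
  define N where "N j = fst (s (Suc j))" for j
  have "incseq N" using Q by (intro incseq_SucI) (simp add: N_def Q_def)
  moreover have "snd (s k) = (\<lambda>x. f x - (\<Sum>j<k. indicator (- K (N j)) x))" for k
  proof (induction k)
    case 0 then show ?case using P[of 0] by (simp add: P_def)
  next
    case (Suc k)
    have "snd (s (Suc k)) = (\<lambda>x. snd (s k) x - indicator (- K (N k)) x)"
      using Q[of k] by (simp add: Q_def N_def)
    then show ?case by (simp add: Suc.IH diff_diff_eq)
  qed
  then have "ereal c < \<phi> (\<lambda>x. f x - (\<Sum>j<k. indicator (- K (N j)) x))" for k
    using P[of k] by (simp add: P_def)
  ultimately show ?thesis by blast
qed

text \<open>The weight is \<open>1 / (e + u)\<close>, where \<open>u\<close> is the possibly infinite number of the chosen sets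
  that miss the point.  A bounded function \<open>g\<close> cannot distinguish \<open>u\<close> from its truncation at a large
  stage \<open>k\<close>.\<close>

lemma weighted_neighbourhood:
  assumes f: "f \<in> B_b" and c: "ereal c < \<phi> f"
  shows "\<exists>w. vanishing_weight K w \<and>
    (\<forall>g\<in>B_b. gauge_of w (\<lambda>x. f x - g x) \<le> 1 \<longrightarrow> ereal c < \<phi> g)"
proof -
  obtain e where e: "0 < e" "ereal c < \<phi> (\<lambda>x. f x - e)" using shift[OF f c] by blast
  have fe: "(\<lambda>x. f x - e) \<in> B_b" by (intro B_b_diff f B_b_const)
  obtain N where N: "incseq N"
    "\<And>k. ereal c < \<phi> (\<lambda>x. f x - e - (\<Sum>j<k. indicator (- K (N j)) x))"
    using decrement_sequence[OF fe e(2)] by blast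
  define u where "u k x = (\<Sum>j<k. indicator (- K (N j)) x :: real)" for k x
  have KN: "K (N i) \<subseteq> K (N j)" if "i \<le> j" for i j
    using that N(1) K_incseq by (simp add: incseq_def)
  have u0: "0 \<le> u k x" for k x by (simp add: u_def sum_nonneg)
  have u_mono: "u i x \<le> u k x" if "i \<le> k" for i k x
    unfolding u_def using that by (intro sum_mono2) auto
  have u_outside: "u k x = real k" if "\<And>j. j < k \<Longrightarrow> x \<notin> K (N j)" for k x
    using that by (simp add: u_def)
  have u_inside: "u i x \<le> u k x" if "x \<in> K (N j)" "j < k" for i j k x
  proof (cases "i \<le> k")
    case False
    have "x \<in> K (N l)" if "k \<le> l" for l
      using KN[of j l] \<open>j < k\<close> \<open>x \<in> K (N j)\<close> that by auto
    then have "u i x = u k x"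
      unfolding u_def using False by (intro sum.mono_neutral_right) auto
    then show ?thesis by simp
  qed (rule u_mono)
  define w where "w x = (INF k. 1 / (e + u k x))" for x
  have eu: "0 < e + u k x" for k x using e u0[of k x] by simp
  have bdd: "bdd_below (range (\<lambda>k. 1 / (e + u k x)))" for x
    using eu by (intro bdd_belowI2[of _ 0]) (simp add: less_imp_le)
  have w_le: "w x \<le> 1 / (e + u k x)" for x k
    unfolding w_def by (intro cINF_lower bdd) simp
  have w_ge: "a \<le> w x" if "\<And>k. a \<le> 1 / (e + u k x)" for a x
    unfolding w_def using that by (intro cINF_greatest) auto
  have vw: "vanishing_weight K w"
    unfolding vanishing_weight_def
  proof (intro conjI allI impI)
    show "0 \<le> w x" for x using eu by (intro w_ge) (simp add: less_imp_le)
    show "\<exists>b. \<forall>x. w x \<le> b" using w_le[of _ 0] by (intro exI[of _ "1 / e"]) (simp add: u_def)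
    fix d :: real assume d: "0 < d"
    obtain j :: nat where j: "1 / d < j" using reals_Archimedean2 by blast
    have "w x \<le> d" if x: "x \<notin> K (N j)" for x
    proof -
      have "u (Suc j) x = real (Suc j)" using x KN[of _ j] by (intro u_outside) (meson less_Suc_eq_le subsetD)
      then have "w x \<le> 1 / (e + real (Suc j))" using w_le[of x "Suc j"] by simp
      also have "\<dots> \<le> 1 / (1 / d)" using j d e by (intro divide_left_mono) auto
      finally show ?thesis by simp
    qed
    then show "\<exists>n. \<forall>x. x \<notin> K n \<longrightarrow> w x \<le> d" by blast
  qed
  have "ereal c < \<phi> g" if g: "g \<in> B_b" and le1: "gauge_of w (\<lambda>x. f x - g x) \<le> 1" for g
  proof -
    have fg: "(\<lambda>x. f x - g x) \<in> B_b" by (intro B_b_diff f g)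
    obtain b where b: "\<And>x. \<bar>f x - g x\<bar> \<le> b" using B_b_bound[OF fg] by blast
    obtain k :: nat where k: "b < k" using reals_Archimedean2 by blast
    have "f x - g x \<le> e + u k x" for x
    proof (cases "\<exists>j<k. x \<in> K (N j)")
      case True
      then have "u i x \<le> u k x" for i using u_inside by blast
      then have "1 / (e + u k x) \<le> w x"
        using eu by (intro w_ge divide_left_mono) auto
      moreover have "w x * (f x - g x) \<le> 1"
        using gauge_of_upper(1)[OF vw fg, of x] le1 by simp
      ultimately have "f x - g x \<le> 0 \<or> 1 / (e + u k x) * (f x - g x) \<le> 1"
        by (meson linear mult_right_mono order_trans)
      then show ?thesis using eu[of k x] by (auto simp: field_simps)
    next
      case False
      then have "u k x = real k" by (intro u_outside) auto
      then show ?thesis using b[of x] k e(1) by simp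
    qed
    then have "(\<lambda>x. f x - e - u k x) \<le> g" by (auto simp: le_fun_def algebra_simps)
    moreover have "(\<lambda>x. f x - e - u k x) \<in> B_b"
      unfolding u_def by (intro B_b_diff f B_b_const B_b_sum B_b_indicator K_borel)
    ultimately have "\<phi> (\<lambda>x. f x - e - u k x) \<le> \<phi> g"
      using increasing_convexD(2)[OF convex g] by blast
    then show ?thesis using N(2)[of k] by (simp add: u_def less_le_trans)
  qed
  with vw show ?thesis by blast
qed

text \<open>By convexity, the bound \<open>\<phi> f - 1\<close> on the gauge ball of radius one around \<open>f\<close> spreads to a lower
  bound of linear growth everywhere.\<close>

lemma finite_point_minorant:
  assumes f: "f \<in> B_b" and fin: "\<phi> f \<noteq> \<infinity>"
  shows "\<exists>w r. vanishing_weight K w \<and>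
    (\<forall>g\<in>B_b. ereal (r - gauge_of w (\<lambda>x. f x - g x)) \<le> \<phi> g)"
proof -
  obtain a where a: "\<phi> f = ereal a" using proper[OF f] fin by (cases "\<phi> f") auto
  obtain w where w: "vanishing_weight K w"
    "\<And>g. g \<in> B_b \<Longrightarrow> gauge_of w (\<lambda>x. f x - g x) \<le> 1 \<Longrightarrow> ereal (a - 1) < \<phi> g"
    using weighted_neighbourhood[OF f, of "a - 1"] a by auto
  have "ereal (a - 1 - gauge_of w (\<lambda>x. f x - g x)) \<le> \<phi> g" if g: "g \<in> B_b" for g
  proof -
    define t where "t = gauge_of w (\<lambda>x. f x - g x)"
    have fg: "(\<lambda>x. f x - g x) \<in> B_b" by (intro B_b_diff f g)
    have t0: "0 \<le> t" unfolding t_def by (rule gauge_of_upper[OF w(1) fg])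
    show ?thesis
    proof (cases "t \<le> 1")
      case True
      have "ereal (a - 1 - t) \<le> ereal (a - 1)" using t0 by simp
      also have "\<dots> \<le> \<phi> g" using w(2)[OF g] True by (simp add: t_def)
      finally show ?thesis by (simp add: t_def)
    next
      case False
      then have t: "1 < t" by simp
      show ?thesis
      proof (cases "\<phi> g")
        case (real b)
        \<comment> \<open>The point of the segment from \<open>f\<close> to \<open>g\<close> at gauge distance one from \<open>f\<close>.\<close>
        define h where "h = (\<lambda>x. 1 / t * g x + (1 - 1 / t) * f x)"
        have h: "h \<in> B_b" unfolding h_def by (intro B_b_add B_b_scale f g)
        have "(\<lambda>x. f x - h x) = (\<lambda>x. 1 / t * (f x - g x))"
          by (auto simp: h_def algebra_simps)
        then have "gauge_of w (\<lambda>x. f x - h x) = 1 / t * t"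
          using sublinear_on_scale[OF sublinear_gauge_of[OF w(1)] _ fg, of "1 / t"] t
          by (simp add: t_def)
        then have "ereal (a - 1) < \<phi> h" using t by (intro w(2) h) simp
        also have "\<dots> \<le> ereal (1 / t) * \<phi> g + ereal (1 - 1 / t) * \<phi> f"
          unfolding h_def using t by (intro increasing_convexD(1)[OF convex] f g) auto
        also have "\<dots> = ereal (1 / t * b + (1 - 1 / t) * a)" by (simp add: real a)
        finally have "a - 1 < 1 / t * b + (1 - 1 / t) * a" by simp
        then have "t * (a - 1) < t * (1 / t * b + (1 - 1 / t) * a)" using t by simp
        also have "\<dots> = b + (t - 1) * a" using t by (simp add: field_simps)
        finally have "a - t < b" by (simp add: algebra_simps)
        then show ?thesis by (simp add: real t_def)
      next
        case MInf then show ?thesis using proper[OF g] by simp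
      qed simp
    qed
  qed
  with w(1) show ?thesis by blast
qed

text \<open>If \<open>\<phi> f\<close> is infinite, convexity alone does not extend the bound \<open>c\<close> beyond a neighbourhood of \<open>f\<close>.
  The minorant at a point \<open>f0\<close> of finiteness controls the functional outside that neighbourhood, where a
  large multiple \<open>k\<close> of the gauge makes the desired bound the weaker of the two.\<close>

lemma gauge_minorant:
  assumes f: "f \<in> B_b" and c: "ereal c < \<phi> f" and f0: "f0 \<in> B_b" "\<phi> f0 \<noteq> \<infinity>"
  shows "\<exists>w. vanishing_weight K w \<and>
    (\<forall>g\<in>B_b. ereal (c - gauge_of w (\<lambda>x. f x - g x)) \<le> \<phi> g)"
proof -
  obtain v r where v: "vanishing_weight K v"
    "\<And>g. g \<in> B_b \<Longrightarrow> ereal (r - gauge_of v (\<lambda>x. f0 x - g x)) \<le> \<phi> g"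
    using finite_point_minorant[OF f0] by blast
  obtain w where w: "vanishing_weight K w"
    "\<And>g. g \<in> B_b \<Longrightarrow> gauge_of w (\<lambda>x. f x - g x) \<le> 1 \<Longrightarrow> ereal c < \<phi> g"
    using weighted_neighbourhood[OF f c] by blast
  define z where "z = (\<lambda>x. v x + w x)"
  have z: "vanishing_weight K z"
    unfolding z_def by (rule vanishing_weight_add[OF K_incseq v(1) w(1)])
  have v0: "0 \<le> v x" "v x \<le> z x" and w0: "0 \<le> w x" "w x \<le> z x" for x
    using v(1) w(1) by (auto simp: vanishing_weight_def z_def)
  have ff0: "(\<lambda>x. f0 x - f x) \<in> B_b" by (intro B_b_diff f f0)
  define q where "q = gauge_of v (\<lambda>x. f0 x - f x)"
  have q0: "0 \<le> q" unfolding q_def by (rule gauge_of_upper[OF v(1) ff0])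
  define k where "k = \<bar>c\<bar> + \<bar>r\<bar> + q + 1"
  have k: "0 < k" using q0 by (simp add: k_def)
  have kz: "vanishing_weight K (\<lambda>x. k * z x)" by (rule vanishing_weight_scale[OF z k])
  have "ereal (c - gauge_of (\<lambda>x. k * z x) (\<lambda>x. f x - g x)) \<le> \<phi> g" if g: "g \<in> B_b" for g
  proof -
    have fg: "(\<lambda>x. f x - g x) \<in> B_b" by (intro B_b_diff f g)
    define t where "t = gauge_of z (\<lambda>x. f x - g x)"
    have kt: "k * t \<le> gauge_of (\<lambda>x. k * z x) (\<lambda>x. f x - g x)"
    proof -
      have "t \<le> gauge_of (\<lambda>x. k * z x) (\<lambda>x. f x - g x) / k"
        unfolding t_def using gauge_of_upper[OF kz fg] k
        by (intro gauge_of_least) (auto simp: field_simps)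
      then show ?thesis using k by (simp add: field_simps)
    qed
    have vt: "gauge_of v (\<lambda>x. f x - g x) \<le> t" and wt: "gauge_of w (\<lambda>x. f x - g x) \<le> t"
      unfolding t_def using v0 w0 by (auto intro!: gauge_of_weight_mono[OF z fg])
    have t0: "0 \<le> t" unfolding t_def by (rule gauge_of_upper[OF z fg])
    have "ereal (c - k * t) \<le> \<phi> g"
    proof (cases "t \<le> 1")
      case True
      have "ereal (c - k * t) \<le> ereal c" using k t0 by simp
      also have "\<dots> \<le> \<phi> g" using w(2)[OF g] wt True by simp
      finally show ?thesis .
    next
      case False
      have "gauge_of v (\<lambda>x. (f0 x - f x) + (f x - g x)) \<le> q + gauge_of v (\<lambda>x. f x - g x)"
        unfolding q_def by (rule sublinear_on_add[OF sublinear_gauge_of[OF v(1)] ff0 fg])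
      then have vq: "gauge_of v (\<lambda>x. f0 x - g x) \<le> q + t" using vt by simp
      have "(\<bar>c\<bar> + \<bar>r\<bar> + q) * 1 \<le> (\<bar>c\<bar> + \<bar>r\<bar> + q) * t"
        using False q0 by (intro mult_left_mono) auto
      then have "c - k * t \<le> r - (q + t)" by (simp add: k_def algebra_simps)
      then have "ereal (c - k * t) \<le> ereal (r - gauge_of v (\<lambda>x. f0 x - g x))" using vq by simp
      also have "\<dots> \<le> \<phi> g" by (rule v(2)[OF g])
      finally show ?thesis .
    qed
    moreover have "ereal (c - gauge_of (\<lambda>x. k * z x) (\<lambda>x. f x - g x)) \<le> ereal (c - k * t)"
      using kt by simp
    ultimately show ?thesis by (rule order_trans[rotated])
  qed
  with kz show ?thesis by blast
qed

text \<open>The constraints are \<open>L (g - f) \<le> b - c\<close> for all \<open>(g, b)\<close> in the epigraph, closed under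
  multiplication by nonnegative numbers.  They form a cone because the epigraph is convex, and they are
  compatible with the gauge by the previous lemma.\<close>

lemma tight_supporting_functional:
  assumes f: "f \<in> B_b" and c: "ereal c < \<phi> f" and f0: "f0 \<in> B_b" "\<phi> f0 \<noteq> \<infinity>"
  shows "\<exists>L w. linear_on B_b L \<and> vanishing_weight K w \<and> (\<forall>h\<in>B_b. L h \<le> gauge_of w h) \<and>
    (\<forall>g\<in>B_b. ereal (c + L g - L f) \<le> \<phi> g)"
proof -
  obtain w where w: "vanishing_weight K w"
    "\<And>g. g \<in> B_b \<Longrightarrow> ereal (c - gauge_of w (\<lambda>x. f x - g x)) \<le> \<phi> g"
    using gauge_minorant[OF assms] by blast
  note sub = sublinear_gauge_of[OF w(1)]
  define G where "G = {(h, s). \<exists>t g b. 0 \<le> t \<and> g \<in> B_b \<and> \<phi> g \<le> ereal b \<and>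
    h = (\<lambda>x. t * (g x - f x)) \<and> s = t * (b - c)}"
  have GI: "((\<lambda>x. t * (g x - f x)), t * (b - c)) \<in> G"
    if "0 \<le> t" "g \<in> B_b" "\<phi> g \<le> ereal b" for t g b
    using that unfolding G_def by blast
  obtain b0 where b0: "\<phi> f0 \<le> ereal b0" using f0(2) by (cases "\<phi> f0") auto
  have "constraint_cone B_b G"
    unfolding constraint_cone_def
  proof (intro conjI allI impI)
    show "fst ` G \<subseteq> B_b" unfolding G_def using f by (auto intro!: B_b_scale B_b_diff)
    show "((\<lambda>x. 0), 0) \<in> G" using GI[OF _ f0(1) b0, of 0] by simp
  next
    fix h1 s1 h2 s2 assume "(h1, s1) \<in> G \<and> (h2, s2) \<in> G"
    then obtain t1 g1 b1 t2 g2 b2 where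
      1: "0 \<le> t1" "g1 \<in> B_b" "\<phi> g1 \<le> ereal b1" "h1 = (\<lambda>x. t1 * (g1 x - f x))" "s1 = t1 * (b1 - c)"
      and 2: "0 \<le> t2" "g2 \<in> B_b" "\<phi> g2 \<le> ereal b2" "h2 = (\<lambda>x. t2 * (g2 x - f x))" "s2 = t2 * (b2 - c)"
      unfolding G_def by blast
    show "((\<lambda>x. h1 x + h2 x), s1 + s2) \<in> G"
    proof (cases "t1 = 0 \<or> t2 = 0")
      case True
      then show ?thesis using GI[OF 1(1-3)] GI[OF 2(1-3)] by (auto simp: 1 2)
    next
      case False
      then have t: "0 < t1" "0 < t2" using 1 2 by auto
      define p where "p = t1 / (t1 + t2)"
      have p: "0 < p" "p < 1" "(t1 + t2) * p = t1" "(t1 + t2) * (1 - p) = t2"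
        using t by (auto simp: p_def field_simps)
      define g where "g = (\<lambda>x. p * g1 x + (1 - p) * g2 x)"
      have g: "g \<in> B_b" unfolding g_def by (intro B_b_add B_b_scale 1 2)
      have "\<phi> g \<le> ereal p * \<phi> g1 + ereal (1 - p) * \<phi> g2"
        unfolding g_def using p by (intro increasing_convexD(1)[OF convex] 1 2)
      also have "\<dots> \<le> ereal p * ereal b1 + ereal (1 - p) * ereal b2"
        using p 1 2 by (intro add_mono ereal_mult_left_mono) auto
      also have "\<dots> = ereal (p * b1 + (1 - p) * b2)" by simp
      finally have "((\<lambda>x. (t1 + t2) * (g x - f x)), (t1 + t2) * (p * b1 + (1 - p) * b2 - c)) \<in> G"
        using t by (intro GI g) auto
      moreover have lin: "(t1 + t2) * (p * a + (1 - p) * b - d) = t1 * (a - d) + t2 * (b - d)" for a b d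
      proof -
        have "(t1 + t2) * (p * a + (1 - p) * b - d)
          = (t1 + t2) * p * a + (t1 + t2) * (1 - p) * b - (t1 + t2) * d" by (simp add: algebra_simps)
        then show ?thesis unfolding p(3,4) by (simp add: algebra_simps)
      qed
      ultimately show ?thesis by (simp only: 1 2 g_def lin)
    qed
  next
    fix a :: real and h s assume a: "0 \<le> a" and "(h, s) \<in> G"
    then obtain t g b where "0 \<le> t" "g \<in> B_b" "\<phi> g \<le> ereal b" "h = (\<lambda>x. t * (g x - f x))" "s = t * (b - c)"
      unfolding G_def by blast
    then show "((\<lambda>x. a * h x), a * s) \<in> G"
      using GI[of "a * t" g b] a by (simp add: mult.assoc)
  qed
  moreover have "0 \<le> gauge_of w (\<lambda>x. - h x) + s" if hs: "(h, s) \<in> G" for h s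
  proof -
    obtain t g b where t: "0 \<le> t" and g: "g \<in> B_b" and b: "\<phi> g \<le> ereal b"
      and h: "h = (\<lambda>x. t * (g x - f x))" and s: "s = t * (b - c)"
      using hs unfolding G_def by blast
    have "(\<lambda>x. - h x) = (\<lambda>x. t * (f x - g x))" by (auto simp: h algebra_simps)
    then have "gauge_of w (\<lambda>x. - h x) = t * gauge_of w (\<lambda>x. f x - g x)"
      using sublinear_on_scale[OF sub t B_b_diff[OF f g]] by simp
    moreover have "c - gauge_of w (\<lambda>x. f x - g x) \<le> b" using order_trans[OF w(2)[OF g] b] by simp
    then have "0 \<le> t * (gauge_of w (\<lambda>x. f x - g x) + (b - c))" using t by simp
    ultimately show ?thesis by (simp add: s distrib_left)
  qed
  ultimately obtain L where L: "linear_on B_b L" "\<forall>h\<in>B_b. L h \<le> gauge_of w h"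
    "\<And>h s. (h, s) \<in> G \<Longrightarrow> L h \<le> s"
    using linear_below_sublinear_with_constraints[OF function_space_B_b sub] by blast
  have "ereal (c + L g - L f) \<le> \<phi> g" if g: "g \<in> B_b" for g
  proof (cases "\<phi> g")
    case (real b)
    then have "L (\<lambda>x. g x - f x) \<le> b - c" using L(3) GI[OF _ g, of 1 b] by simp
    then show ?thesis using linear_on_diff[OF L(1) function_space_B_b g f] by (simp add: real)
  next
    case MInf then show ?thesis using proper[OF g] by simp
  qed simp
  with L w(1) show ?thesis by blast
qed

lemma ca_r_plus_nonempty: "(ca_r_plus :: 'a measure set) \<noteq> {}"
proof -
  have "\<exists>\<mu>\<in>(ca_r_plus :: 'a measure set). \<forall>f\<in>U_b. 0 \<le> integral\<^sup>L \<mu> f"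
    by (rule measure_dominating_functional) (auto simp: linear_on_def intro: exI[of _ "{}"])
  then show ?thesis by blast
qed

lemma supporting_measure:
  assumes f: "f \<in> U_b" and c: "ereal c < \<phi> f"
  shows "\<exists>\<mu>\<in>ca_r_plus. \<forall>g\<in>C_b. ereal (c + integral\<^sup>L \<mu> g - integral\<^sup>L \<mu> f) \<le> \<phi> g"
proof (cases "\<exists>f0\<in>B_b. \<phi> f0 \<noteq> \<infinity>")
  case False
  \<comment> \<open>The functional is constantly infinite, and every regular measure will do.\<close>
  then have "\<phi> g = \<infinity>" if "g \<in> C_b" for g using that C_b_subset_U_b U_b_subset_B_b by blast
  then show ?thesis using ca_r_plus_nonempty by auto
next
  case True
  then obtain f0 where f0: "f0 \<in> B_b" "\<phi> f0 \<noteq> \<infinity>" by blast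
  have fB: "f \<in> B_b" using f U_b_subset_B_b by blast
  obtain L w where L: "linear_on B_b L" and w: "vanishing_weight K w"
    and Lw: "\<And>h. h \<in> B_b \<Longrightarrow> L h \<le> gauge_of w h"
    and below: "\<And>g. g \<in> B_b \<Longrightarrow> ereal (c + L g - L f) \<le> \<phi> g"
    using tight_supporting_functional[OF fB c f0] by blast
  have w0: "0 \<le> w x" for x using w by (simp add: vanishing_weight_def)
  have "\<exists>\<mu>\<in>ca_r_plus. \<forall>f\<in>U_b. L f \<le> integral\<^sup>L \<mu> f"
  proof (rule measure_dominating_functional[OF L])
    fix g h :: "'a \<Rightarrow> real" assume g: "g \<in> B_b" and h: "h \<in> B_b" and "g \<le> h"
    then have "gauge_of w (\<lambda>x. g x - h x) \<le> 0"
      using w0 by (intro gauge_of_least) (auto simp: le_fun_def mult_nonneg_nonpos)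
    with Lw[OF B_b_diff[OF g h]] show "L g \<le> L h"
      using linear_on_diff[OF L function_space_B_b g h] by simp
  next
    fix e :: real assume e: "0 < e"
    then obtain n where n: "\<And>x. x \<notin> K n \<Longrightarrow> w x \<le> e"
      using w unfolding vanishing_weight_def by blast
    have "L (indicator (- K n)) \<le> gauge_of w (indicator (- K n))"
      by (intro Lw B_b_indicator K_borel)
    also have "\<dots> \<le> e" using n e by (intro gauge_of_least) (auto simp: indicator_def)
    finally show "\<exists>C. compact C \<and> L (indicator (- C)) \<le> e" using K_compact by blast
  qed
  then obtain \<mu> where \<mu>: "\<mu> \<in> ca_r_plus" and dom: "\<And>f. f \<in> U_b \<Longrightarrow> L f \<le> integral\<^sup>L \<mu> f" by blast
  have "ereal (c + integral\<^sup>L \<mu> g - integral\<^sup>L \<mu> f) \<le> \<phi> g" if g: "g \<in> C_b" for g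
  proof -
    have gB: "g \<in> B_b" using g C_b_subset_U_b U_b_subset_B_b by blast
    have "L (\<lambda>x. - g x) \<le> (\<integral>x. - g x \<partial>\<mu>)" using dom C_b_minus[OF g] C_b_subset_U_b by blast
    then have "integral\<^sup>L \<mu> g \<le> L g" using linear_on_scale[OF L gB, of "-1"] by simp
    then have "ereal (c + integral\<^sup>L \<mu> g - integral\<^sup>L \<mu> f) \<le> ereal (c + L g - L f)"
      using dom[OF f] by simp
    also have "\<dots> \<le> \<phi> g" by (rule below[OF gB])
    finally show ?thesis .
  qed
  with \<mu> show ?thesis by blast
qed

lemma representation_lower_bound:
  assumes f: "f \<in> U_b"
  shows "\<phi> f \<le> (SUP \<mu>\<in>ca_r_plus. ereal (integral\<^sup>L \<mu> f) - conjugate C_b \<phi> \<mu>)"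
    (is "_ \<le> ?S")
proof (rule ccontr)
  assume "\<not> \<phi> f \<le> ?S"
  then have "?S < \<phi> f" by (simp only: not_le)
  then obtain c where c: "?S < ereal c" "ereal c < \<phi> f" using ereal_dense2 by blast
  obtain \<mu> where \<mu>: "\<mu> \<in> ca_r_plus"
    "\<And>g. g \<in> C_b \<Longrightarrow> ereal (c + integral\<^sup>L \<mu> g - integral\<^sup>L \<mu> f) \<le> \<phi> g"
    using supporting_measure[OF f c(2)] by blast
  have "conjugate C_b \<phi> \<mu> \<le> ereal (integral\<^sup>L \<mu> f - c)"
    unfolding conjugate_def
  proof (rule SUP_least)
    fix g :: "'a \<Rightarrow> real" assume "g \<in> C_b"
    from \<mu>(2)[OF this] show "ereal (integral\<^sup>L \<mu> g) - \<phi> g \<le> ereal (integral\<^sup>L \<mu> f - c)"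
      by (cases "\<phi> g") auto
  qed
  then have "ereal c \<le> ereal (integral\<^sup>L \<mu> f) - conjugate C_b \<phi> \<mu>"
    by (cases "conjugate C_b \<phi> \<mu>") auto
  also have "\<dots> \<le> ?S" using \<mu>(1) by (rule SUP_upper)
  finally show False using c(1) by simp
qed

end

lemma tight_functional_if_condition:
  fixes \<phi> :: "('a::t2_space \<Rightarrow> real) \<Rightarrow> ereal"
  assumes proper: "\<forall>f\<in>B_b. \<phi> f \<noteq> -\<infinity>" and convex: "increasing_convex \<phi>"
    and CD: "condition_C \<phi> \<or> condition_D \<phi>"
  shows "\<exists>K. tight_functional \<phi> K"
  using CD
proof
  assume "condition_C \<phi>"
  then obtain K :: "nat \<Rightarrow> 'a set" where finite: "\<forall>f\<in>B_b. \<bar>\<phi> f\<bar> \<noteq> \<infinity>"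
    and K: "incseq K" "\<forall>m. compact (K m)"
    and conv: "\<forall>F f. incseq F \<and> (\<forall>n. F n \<in> B_b) \<and> f \<in> B_b \<and>
      (\<forall>m n. m \<le> n \<longrightarrow> (\<forall>x. \<bar>f x - F n x\<bar> * indicator (K m) x = 0)) \<longrightarrow>
      converges_from_below (\<lambda>n. \<phi> (F n)) (\<phi> f)"
    unfolding condition_C_def by (elim conjE exE) (rule that)
  have "tight_functional \<phi> K"
  proof
    fix F f assume "incseq F" "\<And>n. F n \<in> B_b" "f \<in> B_b"
      "\<And>m n x. m \<le> n \<Longrightarrow> x \<in> K m \<Longrightarrow> F n x = f x"
    then have "converges_from_below (\<lambda>n. \<phi> (F n)) (\<phi> f)"
      by (intro conv[THEN spec, THEN spec, THEN mp] conjI allI impI) (auto simp: indicator_def)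
    then show "(\<lambda>n. \<phi> (F n)) \<longlonglongrightarrow> \<phi> f" by (simp add: converges_from_below_def)
  next
    \<comment> \<open>A real-valued convex functional is continuous along the constants.\<close>
    fix f :: "'a \<Rightarrow> real" and c :: real assume f: "f \<in> B_b" and c: "ereal c < \<phi> f"
    have f1: "(\<lambda>x. f x + 1) \<in> B_b" by (intro B_b_add f B_b_const)
    obtain a where a: "\<phi> f = ereal a" using finite f by (cases "\<phi> f") auto
    obtain b where b: "\<phi> (\<lambda>x. f x + 1) = ereal b"
      using finite f1 by (cases "\<phi> (\<lambda>x. f x + 1)") auto
    \<comment> \<open>Convexity at \<open>f\<close>, a point of the segment from \<open>f - e\<close> to \<open>f + 1\<close>, gives
      \<open>\<phi> (f - e) \<ge> a - e * (b - a)\<close>, and \<open>e\<close> is chosen to make this exceed \<open>c\<close>.\<close>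
    define e where "e = (a - c) / (\<bar>b - a\<bar> + 1)"
    have ca: "c < a" using c a by simp
    have e: "0 < e" using ca by (simp add: e_def)
    have fe: "(\<lambda>x. f x - e) \<in> B_b" by (intro B_b_diff f B_b_const)
    obtain d where d: "\<phi> (\<lambda>x. f x - e) = ereal d"
      using finite fe by (cases "\<phi> (\<lambda>x. f x - e)") auto
    define t where "t = 1 / (1 + e)"
    have t: "0 < t" "t < 1" "(1 + e) * t = 1" "(1 + e) * (1 - t) = e"
      using e by (auto simp: t_def field_simps)
    have "t * (f x - e) + (1 - t) * (f x + 1) = f x" for x
    proof -
      have "t * (f x - e) + (1 - t) * (f x + 1) = f x + (1 - (1 + e) * t)"
        by (simp add: algebra_simps)
      then show ?thesis by (simp add: t(3))
    qed
    then have "\<phi> f \<le> ereal t * \<phi> (\<lambda>x. f x - e) + ereal (1 - t) * \<phi> (\<lambda>x. f x + 1)"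
      using increasing_convexD(1)[OF convex fe f1 t(1,2)] by simp
    then have "a \<le> t * d + (1 - t) * b" by (simp add: a b d)
    then have "(1 + e) * a \<le> (1 + e) * (t * d + (1 - t) * b)" using e by simp
    also have "\<dots> = ((1 + e) * t) * d + ((1 + e) * (1 - t)) * b" by (simp add: distrib_left)
    finally have "(1 + e) * a \<le> d + e * b" by (simp only: t(3,4) mult_1)
    then have "a - e * (b - a) \<le> d" by (simp add: algebra_simps)
    moreover have "e * (b - a) \<le> e * \<bar>b - a\<bar>" using e by simp
    moreover have "e * \<bar>b - a\<bar> < e * (\<bar>b - a\<bar> + 1)" using e by simp
    moreover have "e * (\<bar>b - a\<bar> + 1) = a - c"
    proof -
      have "\<bar>b - a\<bar> + 1 \<noteq> 0" using abs_ge_zero[of "b - a"] by linarith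
      then show ?thesis by (simp add: e_def)
    qed
    ultimately have "c < d" by linarith
    then show "\<exists>e>0. ereal c < \<phi> (\<lambda>x. f x - e)" using e d by auto
  qed (use proper convex K in auto)
  then show ?thesis by blast
next
  assume "condition_D \<phi>"
  then obtain K :: "nat \<Rightarrow> 'a set" where K: "incseq K" "\<forall>m. compact (K m)"
    and conv: "\<forall>F f. incseq F \<and> (\<forall>n. F n \<in> B_b) \<and> f \<in> B_b \<and>
      (\<forall>m n. m \<le> n \<longrightarrow> (\<forall>x. \<bar>f x - F n x\<bar> * indicator (K m) x \<le> 1 / real (Suc m))) \<longrightarrow>
      converges_from_below (\<lambda>n. \<phi> (F n)) (\<phi> f)"
    unfolding condition_D_def by (elim conjE exE) (rule that)
  have "tight_functional \<phi> K"
  proof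
    fix F f assume "incseq F" "\<And>n. F n \<in> B_b" "f \<in> B_b"
      "\<And>m n x. m \<le> n \<Longrightarrow> x \<in> K m \<Longrightarrow> F n x = f x"
    then have "converges_from_below (\<lambda>n. \<phi> (F n)) (\<phi> f)"
      by (intro conv[THEN spec, THEN spec, THEN mp] conjI allI impI) (auto simp: indicator_def)
    then show "(\<lambda>n. \<phi> (F n)) \<longlonglongrightarrow> \<phi> f" by (simp add: converges_from_below_def)
  next
    fix f :: "'a \<Rightarrow> real" and c :: real assume f: "f \<in> B_b" and c: "ereal c < \<phi> f"
    have "converges_from_below (\<lambda>n. \<phi> (\<lambda>x. f x - 1 / real (Suc n))) (\<phi> f)"
    proof (intro conv[THEN spec, THEN spec, THEN mp] conjI)
      show "incseq (\<lambda>n x. f x - 1 / real (Suc n))"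
        by (auto simp: incseq_def le_fun_def intro!: divide_left_mono)
      show "\<forall>n. (\<lambda>x. f x - 1 / real (Suc n)) \<in> B_b" by (intro allI B_b_diff f B_b_const)
      show "\<forall>m n. m \<le> n \<longrightarrow>
        (\<forall>x. \<bar>f x - (f x - 1 / real (Suc n))\<bar> * indicator (K m) x \<le> 1 / real (Suc m))"
        by (auto simp: indicator_def intro!: divide_left_mono)
    qed (rule f)
    then have "(\<lambda>n. \<phi> (\<lambda>x. f x - 1 / real (Suc n))) \<longlonglongrightarrow> \<phi> f"
      by (simp add: converges_from_below_def)
    then have "\<forall>\<^sub>F n in sequentially. ereal c < \<phi> (\<lambda>x. f x - 1 / real (Suc n))"
      using c by (rule order_tendstoD)
    then obtain n where "ereal c < \<phi> (\<lambda>x. f x - 1 / real (Suc n))"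
      using eventually_happens' sequentially_bot by blast
    then show "\<exists>e>0. ereal c < \<phi> (\<lambda>x. f x - e)"
      by (intro exI[of _ "1 / real (Suc n)"]) simp
  qed (use proper convex K in auto)
  then show ?thesis by blast
qed

section \<open>The representation\<close>

text \<open>Fenchel's inequality.\<close>

lemma conjugate_upper_bound:
  assumes "f \<in> X" "\<phi> f \<noteq> -\<infinity>"
  shows "ereal (integral\<^sup>L \<mu> f) - conjugate X \<phi> \<mu> \<le> \<phi> f"
proof -
  have "ereal (integral\<^sup>L \<mu> f) - \<phi> f \<le> conjugate X \<phi> \<mu>"
    unfolding conjugate_def using assms(1) by (rule SUP_upper)
  then show ?thesis
    using assms(2) by (cases "\<phi> f"; cases "conjugate X \<phi> \<mu>") auto
qed

lemma lower_regularization_upper_bound: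
  assumes \<mu>: "\<mu> \<in> ca_r_plus" and f: "f \<in> B_b" and proper: "\<And>g. g \<in> U_b \<Longrightarrow> \<phi> g \<noteq> -\<infinity>"
  shows "ereal (integral\<^sup>L \<mu> f) - conjugate U_b \<phi> \<mu> \<le> lower_regularization \<phi> f"
proof (rule ereal_le_epsilon2)
  fix e :: real assume "0 < e"
  then obtain g where g: "g \<in> U_b" "g \<le> f" "integral\<^sup>L \<mu> f \<le> integral\<^sup>L \<mu> g + e"
    using integral_inner_approx[OF \<mu> f] by blast
  have "ereal (integral\<^sup>L \<mu> f) - conjugate U_b \<phi> \<mu>
      \<le> ereal (integral\<^sup>L \<mu> g + e) - conjugate U_b \<phi> \<mu>"
    using g(3) by (intro ereal_minus_mono) auto
  also have "\<dots> = ereal (integral\<^sup>L \<mu> g) - conjugate U_b \<phi> \<mu> + ereal e"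
    by (cases "conjugate U_b \<phi> \<mu>") auto
  also have "\<dots> \<le> \<phi> g + ereal e"
    by (intro add_right_mono conjugate_upper_bound g(1) proper)
  also have "\<phi> g \<le> lower_regularization \<phi> f"
    unfolding lower_regularization_def using g by (intro SUP_upper) simp
  finally show "ereal (integral\<^sup>L \<mu> f) - conjugate U_b \<phi> \<mu> \<le> lower_regularization \<phi> f + ereal e"
    by (simp add: add_right_mono)
qed

theorem theorem1p7:
  fixes \<phi> :: "('a::t2_space \<Rightarrow> real) \<Rightarrow> ereal"
  assumes "\<forall>f\<in>B_b. \<phi> f \<noteq> -\<infinity>"
    and "increasing_convex \<phi>"
    and "condition_C \<phi> \<or> condition_D \<phi>"
  shows "(\<forall>f\<in>C_b. \<phi> f = (SUP \<mu>\<in>ca_r_plus. ereal (integral\<^sup>L \<mu> f) - conjugate C_b \<phi> \<mu>)) \<and>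
    (\<forall>f\<in>U_b. \<phi> f \<le> (SUP \<mu>\<in>ca_r_plus. ereal (integral\<^sup>L \<mu> f) - conjugate C_b \<phi> \<mu>)) \<and>
    (\<forall>f\<in>B_b. lower_regularization \<phi> f
        \<le> (SUP \<mu>\<in>ca_r_plus. ereal (integral\<^sup>L \<mu> f) - conjugate C_b \<phi> \<mu>)) \<and>
    ((\<forall>\<mu>\<in>ca_r_plus. conjugate C_b \<phi> \<mu> = conjugate U_b \<phi> \<mu>) \<longrightarrow>
      (\<forall>f\<in>U_b. \<phi> f = (SUP \<mu>\<in>ca_r_plus. ereal (integral\<^sup>L \<mu> f) - conjugate C_b \<phi> \<mu>)) \<and>
      (\<forall>f\<in>B_b. lower_regularization \<phi> f
          = (SUP \<mu>\<in>ca_r_plus. ereal (integral\<^sup>L \<mu> f) - conjugate C_b \<phi> \<mu>))) \<and>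
    (lower_regular \<phi> \<and> (\<forall>\<mu>\<in>ca_r_plus. conjugate C_b \<phi> \<mu> = conjugate U_b \<phi> \<mu>) \<longrightarrow>
      (\<forall>f\<in>B_b. \<phi> f = (SUP \<mu>\<in>ca_r_plus. ereal (integral\<^sup>L \<mu> f) - conjugate C_b \<phi> \<mu>)))"
proof -
  obtain K where "tight_functional \<phi> K" using tight_functional_if_condition[OF assms] by blast
  then interpret tight_functional \<phi> K .
  define S where "S f = (SUP \<mu>\<in>ca_r_plus. ereal (integral\<^sup>L \<mu> f) - conjugate C_b \<phi> \<mu>)"
    for f :: "'a \<Rightarrow> real"
  have CU: "f \<in> C_b \<Longrightarrow> f \<in> U_b" and UB: "f \<in> U_b \<Longrightarrow> f \<in> B_b" for f :: "'a \<Rightarrow> real"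
    using C_b_subset_U_b U_b_subset_B_b by blast+
  have U_le: "\<phi> f \<le> S f" if "f \<in> U_b" for f
    unfolding S_def by (rule representation_lower_bound[OF that])
  have C_eq: "\<phi> f = S f" if f: "f \<in> C_b" for f
  proof (rule antisym)
    show "\<phi> f \<le> S f" by (rule U_le[OF CU[OF f]])
    show "S f \<le> \<phi> f"
      unfolding S_def using proper UB CU f by (intro SUP_least conjugate_upper_bound) auto
  qed
  have S_mono: "S g \<le> S f" if "g \<le> f" "g \<in> B_b" "f \<in> B_b" for f g
    unfolding S_def
  proof (rule SUP_mono)
    fix \<mu> :: "'a measure" assume \<mu>: "\<mu> \<in> ca_r_plus"
    have "integral\<^sup>L \<mu> g \<le> integral\<^sup>L \<mu> f"
      using that by (intro integral_mono B_b_integrable[OF \<mu>]) (auto simp: le_fun_def)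
    then have "ereal (integral\<^sup>L \<mu> g) - conjugate C_b \<phi> \<mu> \<le>
        ereal (integral\<^sup>L \<mu> f) - conjugate C_b \<phi> \<mu>"
      by (intro ereal_minus_mono) auto
    with \<mu> show "\<exists>\<nu>\<in>ca_r_plus. ereal (integral\<^sup>L \<mu> g) - conjugate C_b \<phi> \<mu> \<le>
        ereal (integral\<^sup>L \<nu> f) - conjugate C_b \<phi> \<nu>" by blast
  qed
  have reg_le: "lower_regularization \<phi> f \<le> S f" if f: "f \<in> B_b" for f
    unfolding lower_regularization_def
  proof (rule SUP_least)
    fix g assume "g \<in> {g \<in> U_b. g \<le> f}"
    then have g: "g \<in> U_b" "g \<le> f" by auto
    have "\<phi> g \<le> S g" by (rule U_le[OF g(1)])
    also have "\<dots> \<le> S f" by (rule S_mono[OF g(2) UB[OF g(1)] f])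
    finally show "\<phi> g \<le> S f" .
  qed
  have equal: "(\<forall>f\<in>U_b. \<phi> f = S f) \<and> (\<forall>f\<in>B_b. lower_regularization \<phi> f = S f)"
    if conj: "\<forall>\<mu>\<in>ca_r_plus. conjugate C_b \<phi> \<mu> = conjugate U_b \<phi> \<mu>"
  proof -
    have S_U: "S f = (SUP \<mu>\<in>ca_r_plus. ereal (integral\<^sup>L \<mu> f) - conjugate U_b \<phi> \<mu>)" for f
      unfolding S_def using conj by (intro SUP_cong) auto
    have "S f \<le> \<phi> f" if f: "f \<in> U_b" for f
      unfolding S_U using proper UB f by (intro SUP_least conjugate_upper_bound) auto
    moreover have "S f \<le> lower_regularization \<phi> f" if f: "f \<in> B_b" for f
      unfolding S_U using proper UB f by (intro SUP_least lower_regularization_upper_bound) auto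
    ultimately show ?thesis using U_le reg_le by (auto intro: antisym)
  qed
  show ?thesis
    unfolding S_def[symmetric]
    using C_eq U_le reg_le equal by (auto simp: lower_regular_def)
qed

end
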